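(* Let $\mathbb{K}$ be a quadratically closed field with $\operatorname{char}\mathbb{K}\ne2$ (this includes $\mathbb{K}=\mathbb{C}$), and consider universal conformal geometries $(V,Q,P,L)$ over $\mathbb{K}$, with $n=\dim V$. The quadratic form $Q$ has a unique form (up to isomorphism), and it contains a symplectic subspace of maximal dimension ($n$ or $n-1$, whichever is even), hence the geometry is non-degenerate if $n\ge4$. The norms of $P$ and $L$ are either $0$ or $1$ up to a square, hence in each dimension there are $4$ geometries.
   Context: A field is quadratically closed if every element is a square. For a quadratic form $Q$, $B(u,v)=Q(u+v)-Q(u)-Q(v)$ is the associated bilinear form. A universal conformal geometry of dimension $d$ over a field $\mathbb{K}$ is a tuple $(V,Q,P,L)$ where $V$ is a vector space of dimension $d+3$ over $\mathbb{K}$, $Q$ is a non-degenerate quadratic form with non-degenerate associated bilinear form $B$, and $P,L\in\mathbb{P}V$ are orthogonal with respect to $B$. Geometries are considered up to isomorphism, where $Q$ may be multiplied by any non-zero scalar without altering the isomorphism class. The norm of a point $[v]\in\mathbb{P}V$ is the class of $Q(v)$ in $\mathbb{K}^\times/(\mathbb{K}^\times)^2\cup\{0\}$. A symplectic subspace of dimension $2m$ is a subspace on which $Q$ can be written as $x_1x_2+x_3x_4+\dots+x_{2m-1}x_{2m}$ in some basis. A hypercycle is a $c\in\mathbb{P}V$ with $Q(c)=0$; it is a point if $B(P,c)=0$, a hyperplane if $B(L,c)=0$, and ideal if both hold. The geometry is non-degenerate if there are a non-ideal point $p$ and a non-ideal hyperplane $h$ with $B(p,h)=0$.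
   Formalization: For n ≥ 4 the non-degeneracy claim and the count of 4 geometries are stated for P ≠ L only: if P = L is a singular point (orthogonal to itself), every point is an ideal hyperplane, so the geometry is degenerate and forms a fifth class. For n = 3, P = L is allowed. *)

theory Defs
  imports
    "HOL-Library.Function_Algebras"
    "HOL-Computational_Algebra.Computational_Algebra"
begin

text \<open>
  All vector spaces are subspaces \<open>V\<close> of some ambient vector space with scalar
  multiplication \<open>s\<close>; a quadratic form on \<open>V\<close> is a function on the ambient type of which
  only the values on \<open>V\<close> matter.
\<close>

definition quadratically_closed :: "'k::field itself \<Rightarrow> bool" where
  "quadratically_closed _ \<longleftrightarrow> (\<forall>a::'k. \<exists>b. a = b\<^sup>2)"

definition polar :: "('v::ab_group_add \<Rightarrow> 'k::field) \<Rightarrow> 'v \<Rightarrow> 'v \<Rightarrow> 'k" where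
  "polar Q u v = Q (u + v) - Q u - Q v"

definition bilinear_form_on ::
  "('k::field \<Rightarrow> 'v::ab_group_add \<Rightarrow> 'v) \<Rightarrow> 'v set \<Rightarrow> ('v \<Rightarrow> 'v \<Rightarrow> 'k) \<Rightarrow> bool" where
  "bilinear_form_on s V B \<longleftrightarrow>
     (\<forall>u\<in>V. \<forall>v\<in>V. \<forall>w\<in>V. B (u + v) w = B u w + B v w \<and> B w (u + v) = B w u + B w v) \<and>
     (\<forall>a. \<forall>u\<in>V. \<forall>v\<in>V. B (s a u) v = a * B u v \<and> B u (s a v) = a * B u v)"

definition quadratic_form_on ::
  "('k::field \<Rightarrow> 'v::ab_group_add \<Rightarrow> 'v) \<Rightarrow> 'v set \<Rightarrow> ('v \<Rightarrow> 'k) \<Rightarrow> bool" where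
  "quadratic_form_on s V Q \<longleftrightarrow>
     (\<forall>a. \<forall>v\<in>V. Q (s a v) = a\<^sup>2 * Q v) \<and> bilinear_form_on s V (polar Q)"

definition nondegenerate_bilinear_on ::
  "'v::ab_group_add set \<Rightarrow> ('v \<Rightarrow> 'v \<Rightarrow> 'k::field) \<Rightarrow> bool" where
  "nondegenerate_bilinear_on V B \<longleftrightarrow> (\<forall>u\<in>V. (\<forall>v\<in>V. B u v = 0) \<longrightarrow> u = 0)"

text \<open>
  Non-degeneracy of the quadratic form itself: no non-zero singular vector in the radical of
  the polar form. It is implied by non-degeneracy of the polar form, which the notion of a
  geometry below requires separately.
\<close>

definition nondegenerate_quadratic_on ::
  "'v::ab_group_add set \<Rightarrow> ('v \<Rightarrow> 'k::field) \<Rightarrow> bool" where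
  "nondegenerate_quadratic_on V Q \<longleftrightarrow>
     (\<forall>u\<in>V. (\<forall>v\<in>V. polar Q u v = 0) \<and> Q u = 0 \<longrightarrow> u = 0)"

text \<open>A point of the projective space is represented by the corresponding line through \<open>0\<close>.\<close>

definition projective_points ::
  "('k::field \<Rightarrow> 'v::ab_group_add \<Rightarrow> 'v) \<Rightarrow> 'v set \<Rightarrow> 'v set set" where
  "projective_points s V = {module.span s {v} |v. v \<in> V \<and> v \<noteq> 0}"

definition orthogonal_points ::
  "('v::ab_group_add \<Rightarrow> 'k::field) \<Rightarrow> 'v set \<Rightarrow> 'v set \<Rightarrow> bool" where
  "orthogonal_points Q p q \<longleftrightarrow> (\<forall>u\<in>p. \<forall>v\<in>q. polar Q u v = 0)"

definition square_class :: "'k::field \<Rightarrow> 'k set" where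
  "square_class a = {a * c\<^sup>2 |c. c \<noteq> 0}"

text \<open>The union is over equal sets: all non-zero vectors of a line have the same square class.\<close>

definition point_norm :: "('v::ab_group_add \<Rightarrow> 'k::field) \<Rightarrow> 'v set \<Rightarrow> 'k set" where
  "point_norm Q p = (\<Union>v\<in>p - {0}. square_class (Q v))"

record ('k, 'v) geometry =
  space :: "'v set"
  form :: "'v \<Rightarrow> 'k"
  ptP :: "'v set"
  ptL :: "'v set"

text \<open>
  Since \<open>d + 3 > 0\<close> and the dimension of an infinite-dimensional space is \<open>0\<close> by
  convention, the dimension condition forces \<open>V\<close> to be finite-dimensional.
  The points \<open>P\<close> and \<open>L\<close> are not required to be distinct here.
\<close>

definition universal_conformal_geometry ::
  "('k::field \<Rightarrow> 'v::ab_group_add \<Rightarrow> 'v) \<Rightarrow> nat \<Rightarrow> ('k, 'v) geometry \<Rightarrow> bool" where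
  "universal_conformal_geometry s d G \<longleftrightarrow>
     module.subspace s (space G) \<and>
     vector_space.dim s (space G) = d + 3 \<and>
     quadratic_form_on s (space G) (form G) \<and>
     nondegenerate_quadratic_on (space G) (form G) \<and>
     nondegenerate_bilinear_on (space G) (polar (form G)) \<and>
     ptP G \<in> projective_points s (space G) \<and>
     ptL G \<in> projective_points s (space G) \<and>
     orthogonal_points (form G) (ptP G) (ptL G)"

definition linear_iso_on ::
  "('k::field \<Rightarrow> 'v::ab_group_add \<Rightarrow> 'v) \<Rightarrow> ('k \<Rightarrow> 'w::ab_group_add \<Rightarrow> 'w) \<Rightarrow>
   'v set \<Rightarrow> 'w set \<Rightarrow> ('v \<Rightarrow> 'w) \<Rightarrow> bool" where
  "linear_iso_on s s' V W f \<longleftrightarrow>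
     bij_betw f V W \<and>
     (\<forall>u\<in>V. \<forall>v\<in>V. f (u + v) = f u + f v) \<and>
     (\<forall>a. \<forall>v\<in>V. f (s a v) = s' a (f v))"

definition isometric_forms ::
  "('k::field \<Rightarrow> 'v::ab_group_add \<Rightarrow> 'v) \<Rightarrow> ('k \<Rightarrow> 'w::ab_group_add \<Rightarrow> 'w) \<Rightarrow>
   'v set \<Rightarrow> ('v \<Rightarrow> 'k) \<Rightarrow> 'w set \<Rightarrow> ('w \<Rightarrow> 'k) \<Rightarrow> bool" where
  "isometric_forms s s' V Q W Q' \<longleftrightarrow>
     (\<exists>f. linear_iso_on s s' V W f \<and> (\<forall>v\<in>V. Q' (f v) = Q v))"

definition isomorphic_geometries ::
  "('k::field \<Rightarrow> 'v::ab_group_add \<Rightarrow> 'v) \<Rightarrow> ('k \<Rightarrow> 'w::ab_group_add \<Rightarrow> 'w) \<Rightarrow>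
   ('k, 'v) geometry \<Rightarrow> ('k, 'w) geometry \<Rightarrow> bool" where
  "isomorphic_geometries s s' G H \<longleftrightarrow>
     (\<exists>f c. c \<noteq> 0 \<and> linear_iso_on s s' (space G) (space H) f \<and>
        (\<forall>v\<in>space G. form H (f v) = c * form G v) \<and>
        f ` ptP G = ptP H \<and> f ` ptL G = ptL H)"

definition symplectic_subspace ::
  "('k::field \<Rightarrow> 'v::ab_group_add \<Rightarrow> 'v) \<Rightarrow> ('v \<Rightarrow> 'k) \<Rightarrow> nat \<Rightarrow> 'v set \<Rightarrow> bool" where
  "symplectic_subspace s Q m W \<longleftrightarrow>
     (\<exists>b::nat \<Rightarrow> 'v. inj_on b {..<2 * m} \<and>
        \<not> module.dependent s (b ` {..<2 * m}) \<and> module.span s (b ` {..<2 * m}) = W \<and>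
        (\<forall>x::nat \<Rightarrow> 'k. Q (\<Sum>i<2 * m. s (x i) (b i)) = (\<Sum>j<m. x (2 * j) * x (2 * j + 1))))"

definition hypercycle ::
  "('k::field \<Rightarrow> 'v::ab_group_add \<Rightarrow> 'v) \<Rightarrow> ('k, 'v) geometry \<Rightarrow> 'v set \<Rightarrow> bool" where
  "hypercycle s G c \<longleftrightarrow> c \<in> projective_points s (space G) \<and> (\<forall>v\<in>c. form G v = 0)"

definition is_point ::
  "('k::field \<Rightarrow> 'v::ab_group_add \<Rightarrow> 'v) \<Rightarrow> ('k, 'v) geometry \<Rightarrow> 'v set \<Rightarrow> bool" where
  "is_point s G c \<longleftrightarrow> hypercycle s G c \<and> orthogonal_points (form G) (ptP G) c"

definition is_hyperplane ::
  "('k::field \<Rightarrow> 'v::ab_group_add \<Rightarrow> 'v) \<Rightarrow> ('k, 'v) geometry \<Rightarrow> 'v set \<Rightarrow> bool" where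
  "is_hyperplane s G c \<longleftrightarrow> hypercycle s G c \<and> orthogonal_points (form G) (ptL G) c"

definition is_ideal ::
  "('k::field \<Rightarrow> 'v::ab_group_add \<Rightarrow> 'v) \<Rightarrow> ('k, 'v) geometry \<Rightarrow> 'v set \<Rightarrow> bool" where
  "is_ideal s G c \<longleftrightarrow> is_point s G c \<and> is_hyperplane s G c"

definition nondegenerate_geometry ::
  "('k::field \<Rightarrow> 'v::ab_group_add \<Rightarrow> 'v) \<Rightarrow> ('k, 'v) geometry \<Rightarrow> bool" where
  "nondegenerate_geometry s G \<longleftrightarrow>
     (\<exists>p h. is_point s G p \<and> \<not> is_ideal s G p \<and>
        is_hyperplane s G h \<and> \<not> is_ideal s G h \<and> orthogonal_points (form G) p h)"

text \<open>
  For \<open>n = d + 3 \<ge> 4\<close> there is, besides the geometries with \<open>P \<noteq> L\<close>, the degenerate case in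
  which \<open>P = L\<close> is a singular point: every point is then a hyperplane and vice versa, so that
  all of them are ideal. It has the same norms as a geometry with \<open>P \<noteq> L\<close> both singular and
  is excluded. For \<open>n = 3\<close> no two distinct singular points are orthogonal, so \<open>P = L\<close> is the
  only possibility with both norms zero, and it is admitted.
\<close>

definition proper_geometry ::
  "('k::field \<Rightarrow> 'v::ab_group_add \<Rightarrow> 'v) \<Rightarrow> nat \<Rightarrow> ('k, 'v) geometry \<Rightarrow> bool" where
  "proper_geometry s d G \<longleftrightarrow>
     universal_conformal_geometry s d G \<and> (d + 3 \<ge> 4 \<longrightarrow> ptP G \<noteq> ptL G)"

definition geometry_classes ::
  "('k::field \<Rightarrow> 'v::ab_group_add \<Rightarrow> 'v) \<Rightarrow> nat \<Rightarrow> ('k, 'v) geometry set set" where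
  "geometry_classes s d =
     {G. proper_geometry s d G} //
     {(G, H). proper_geometry s d G \<and> proper_geometry s d H \<and> isomorphic_geometries s s G H}"

text \<open>
  Pointwise scalar multiplication on sequences: an ambient space with subspaces of every
  finite dimension.
\<close>

definition seq_scale :: "'k::field \<Rightarrow> (nat \<Rightarrow> 'k) \<Rightarrow> nat \<Rightarrow> 'k" where
  "seq_scale c x = (\<lambda>i. c * x i)"

end

theory Submission
  imports Defs
begin

text \<open>
  Every orthonormal family extends to an orthonormal basis, because every vector with
  \<open>Q \<noteq> 0\<close> can be scaled to norm 1 and the orthogonal complement of the family contains such a
  vector. With \<open>\<iota>\<^sup>2 = -1\<close>, a singular vector orthogonal to such a family is \<open>a + \<iota> b\<close> for
  two further orthonormal vectors \<open>a, b\<close>. Starting the basis with vectors adapted to \<open>P\<close> and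
  \<open>L\<close>, one finds coordinates in which \<open>Q\<close> is a sum of squares and \<open>P, L\<close> are one of five
  standard pairs. The norms of \<open>P\<close> and \<open>L\<close> determine which one, apart from the singular case
  \<open>P = L\<close>, which is improper unless \<open>n = 3\<close>. The planes spanned by two basis vectors are
  hyperbolic, since \<open>x\<^sup>2 + y\<^sup>2 = (x + \<iota> y) (x - \<iota> y)\<close>.
\<close>

text \<open>An isomorphism has to match \<open>Q\<close> and two lines at once, so diagonalising
  \<open>Q\<close> alone does not suffice. Building the basis around \<open>P\<close> and
  \<open>L\<close> takes the place of an extension theorem for isometries. The obstacle is that a
  singular vector cannot belong to an orthonormal family: it needs a partner spanning a hyperbolic
  plane with it, and the partner decides where that plane lies. If \<open>P\<close> and
  \<open>L\<close> are distinct and both singular, the partner of \<open>P\<close> has to be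
  orthogonal to \<open>L\<close>; only then can \<open>L\<close> receive a plane of its own in the
  complement. The two planes fill four dimensions, which is why n = 3 behaves differently. The
  scalar allowed in an isomorphism cannot disturb the norms, because every non-zero scalar is a
  square and a norm therefore only records whether \<open>Q\<close> vanishes on the line. The count
  of classes is a count of the pairs of norms that occur.\<close>

lemma (in vector_space) independent_familyI:
  fixes b :: "nat \<Rightarrow> 'b"
  assumes "\<And>x. (\<Sum>i<N. scale (x i) (b i)) = 0 \<Longrightarrow> \<forall>i<N. x i = 0"
  shows "inj_on b {..<N}" "independent (b ` {..<N})"
proof -
  show inj: "inj_on b {..<N}"
  proof (rule inj_onI, rule ccontr)
    fix i j assume ij: "i \<in> {..<N}" "j \<in> {..<N}" "b i = b j" "i \<noteq> j"
    \<comment> \<open>Equal vectors at different indices satisfy \<open>b i - b j = 0\<close>, a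
      relation with non-zero coefficients.\<close>
    let ?x = "\<lambda>k. if k = i then 1 else if k = j then - 1 else (0::'a)"
    have "(\<Sum>k<N. scale (?x k) (b k)) =
        (\<Sum>k<N. (if k = i then b k else 0) + (if k = j then - b k else 0))"
      using ij by (intro sum.cong) auto
    also have "\<dots> = 0"
      unfolding sum.distrib using ij by (simp add: sum.delta)
    finally have "\<forall>k<N. ?x k = 0" by (rule assms)
    then show False using ij(1) by (auto dest: spec[of _ i])
  qed
  show "independent (b ` {..<N})"
  proof
    assume "dependent (b ` {..<N})"
    then obtain u where u: "\<exists>v\<in>b ` {..<N}. u v \<noteq> 0" "(\<Sum>v\<in>b ` {..<N}. scale (u v) v) = 0"
      by (auto simp: dependent_finite)
    from u(2) have "(\<Sum>i<N. scale (u (b i)) (b i)) = 0"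
      by (simp add: sum.reindex[OF inj])
    from assms[OF this] u(1) show False by auto
  qed
qed

text \<open>A positive \<open>dim\<close> certifies a finite basis, since an infinite one would have
  cardinality 0; the exchange bound then applies to \<open>S\<close>.\<close>

lemma (in vector_space) independent_card_le_dim:
  assumes "dim V > 0" "independent S" "S \<subseteq> V"
  shows "card S \<le> dim V"
proof -
  obtain C where C: "C \<subseteq> V" "independent C" "V \<subseteq> span C" "card C = dim V"
    by (rule basis_exists[of V])
  have "finite C" using assms(1) C(4) card.infinite[of C] by fastforce
  then show ?thesis using independent_span_bound[of C S] assms C by auto
qed

lemma (in vector_space) span_scale_singleton:
  assumes "c \<noteq> 0"
  shows "span {scale c v} = span {v}"
proof -
  have "scale k v \<in> range (\<lambda>k. scale (k * c) v)" for k
    by (rule image_eqI[of _ _ "k / c"]) (use assms in auto)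
  then show ?thesis unfolding span_singleton by auto
qed

subsection \<open>Orthonormal families\<close>

text \<open>Chosen once per field, outside any quadratic space, so that the coordinate models and
  the abstract spaces use the same root. Without a root in the field the value is
  unspecified.\<close>

definition sqrt_minus_one :: "'k::field" where
  "sqrt_minus_one = (SOME c. c * c = - 1)"

locale regular_quadratic_space = vector_space s
  for s :: "'k::field \<Rightarrow> 'v::ab_group_add \<Rightarrow> 'v" +
  fixes V :: "'v set" and Q :: "'v \<Rightarrow> 'k"
  assumes subspace_V: "subspace V"
    and quadratic: "quadratic_form_on s V Q"
    and nondegenerate: "nondegenerate_bilinear_on V (polar Q)"
    and quadratically_closed: "quadratically_closed TYPE('k)"
    and two_nonzero: "(2::'k) \<noteq> 0"
begin

abbreviation B :: "'v \<Rightarrow> 'v \<Rightarrow> 'k" where "B \<equiv> polar Q"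
abbreviation \<iota> :: 'k where "\<iota> \<equiv> sqrt_minus_one"

lemma iota_squared [simp]: "\<iota> * \<iota> = - 1"
proof -
  obtain c :: 'k where "- 1 = c\<^sup>2"
    using quadratically_closed unfolding quadratically_closed_def by blast
  then have "\<exists>c::'k. c * c = - 1" by (metis power2_eq_square)
  then show ?thesis unfolding sqrt_minus_one_def by (rule someI_ex)
qed

lemma iota_squared_left [simp]: "\<iota> * (\<iota> * a) = - a"
  by (simp flip: mult.assoc)

lemma iota_nonzero [simp]: "\<iota> \<noteq> 0"
  by (metis iota_squared mult_zero_left neg_equal_0_iff_equal zero_neq_one)

lemma four_nonzero: "(4::'k) \<noteq> 0"
  using no_zero_divisors[OF two_nonzero two_nonzero] by simp

lemma V_closed [simp, intro]:
  "0 \<in> V"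
  "u \<in> V \<Longrightarrow> v \<in> V \<Longrightarrow> u + v \<in> V"
  "u \<in> V \<Longrightarrow> v \<in> V \<Longrightarrow> u - v \<in> V"
  "v \<in> V \<Longrightarrow> s a v \<in> V"
  "(\<And>i. i \<in> A \<Longrightarrow> f i \<in> V) \<Longrightarrow> sum f A \<in> V"
  using subspace_V by (auto intro: subspace_0 subspace_add subspace_diff subspace_scale subspace_sum)

lemma Q_scale: "v \<in> V \<Longrightarrow> Q (s a v) = a\<^sup>2 * Q v"
  using quadratic by (auto simp: quadratic_form_on_def)

lemma B_commute: "B u v = B v u"
  by (simp add: polar_def algebra_simps)

lemma Q_add: "Q (u + v) = Q u + Q v + B u v"
  by (simp add: polar_def)

lemma B_linear [simp]:
  "u \<in> V \<Longrightarrow> v \<in> V \<Longrightarrow> w \<in> V \<Longrightarrow> B (u + v) w = B u w + B v w"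
  "u \<in> V \<Longrightarrow> v \<in> V \<Longrightarrow> w \<in> V \<Longrightarrow> B w (u + v) = B w u + B w v"
  "u \<in> V \<Longrightarrow> v \<in> V \<Longrightarrow> B (s a u) v = a * B u v"
  "u \<in> V \<Longrightarrow> v \<in> V \<Longrightarrow> B u (s a v) = a * B u v"
  using quadratic by (auto simp: quadratic_form_on_def bilinear_form_on_def)

lemma B_diff [simp]:
  assumes "u \<in> V" "v \<in> V" "w \<in> V"
  shows "B (u - v) w = B u w - B v w" "B w (u - v) = B w u - B w v"
proof -
  have "B (u + s (- 1) v) w = B u w - B v w"
    using assms by (simp del: scale_minus_left)
  then show "B (u - v) w = B u w - B v w" by simp
  then show "B w (u - v) = B w u - B w v" by (simp add: B_commute)
qed

lemma B_zero [simp]: "v \<in> V \<Longrightarrow> B 0 v = 0" "v \<in> V \<Longrightarrow> B v 0 = 0"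
  using B_linear(3)[of 0 v 0] B_linear(4)[of v 0 0] by auto

lemma Q_zero [simp]: "Q 0 = 0"
  using Q_scale[of 0 0] by simp

lemma B_self: "v \<in> V \<Longrightarrow> B v v = 2 * Q v"
proof -
  assume v: "v \<in> V"
  have "v + v = s 2 v" using scale_left_distrib[of 1 1 v] by simp
  then show ?thesis using Q_scale[OF v, of 2] by (simp add: polar_def power2_eq_square)
qed

lemma Q_eq: "v \<in> V \<Longrightarrow> Q v = B v v / 2"
  using two_nonzero by (simp add: B_self)

lemma B_sum:
  assumes "\<And>i. i \<in> A \<Longrightarrow> f i \<in> V" "v \<in> V"
  shows "B (\<Sum>i\<in>A. f i) v = (\<Sum>i\<in>A. B (f i) v)"
  using assms by (induction A rule: infinite_finite_induct) auto

lemma ex_polar_nonzero: "u \<in> V \<Longrightarrow> u \<noteq> 0 \<Longrightarrow> \<exists>v\<in>V. B u v \<noteq> 0"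
  using nondegenerate by (auto simp: nondegenerate_bilinear_on_def)

lemma ex_normalize:
  assumes "v \<in> V" "Q v \<noteq> 0"
  obtains c where "c \<noteq> 0" "B (s c v) (s c v) = 2"
proof -
  obtain c where c: "inverse (Q v) = c\<^sup>2"
    using quadratically_closed unfolding quadratically_closed_def by blast
  then have "c\<^sup>2 * Q v = 1" using assms by (metis left_inverse)
  moreover from c have "c \<noteq> 0" using assms by auto
  ultimately show ?thesis using assms
    by (intro that[of c]) (auto simp: B_self Q_scale simp del: B_linear)
qed

text \<open>The 2 comes from \<open>B v v = 2 * Q v\<close>: the vectors have norm \<open>Q v = 1\<close>.\<close>

definition orthonormal :: "(nat \<Rightarrow> 'v) \<Rightarrow> nat \<Rightarrow> bool" where
  "orthonormal e k \<longleftrightarrow> (\<forall>i<k. e i \<in> V) \<and> (\<forall>i<k. \<forall>j<k. B (e i) (e j) = (if i = j then 2 else 0))"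

definition comb :: "nat \<Rightarrow> (nat \<Rightarrow> 'v) \<Rightarrow> (nat \<Rightarrow> 'k) \<Rightarrow> 'v" where
  "comb k e x = (\<Sum>i<k. s (x i) (e i))"

lemma orthonormal_in: "orthonormal e k \<Longrightarrow> i < k \<Longrightarrow> e i \<in> V"
  by (simp add: orthonormal_def)

lemma orthonormal_B: "orthonormal e k \<Longrightarrow> i < k \<Longrightarrow> j < k \<Longrightarrow> B (e i) (e j) = (if i = j then 2 else 0)"
  by (simp add: orthonormal_def)

lemma orthonormal_append:
  assumes "orthonormal e k" "v \<in> V" "B v v = 2" "\<And>i. i < k \<Longrightarrow> B v (e i) = 0"
  shows "orthonormal (e(k := v)) (Suc k)"
proof -
  have "B (e i) v = 0" if "i < k" for i using assms(4)[OF that] by (simp only: B_commute)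
  then show ?thesis using assms by (simp add: orthonormal_def less_Suc_eq)
qed

lemma comb_in [simp]: "orthonormal e k \<Longrightarrow> comb k e x \<in> V"
  by (auto simp: comb_def orthonormal_in)

text \<open>Pairing with \<open>e j\<close> reads off a coordinate up to the invertible factor 2.
  Independence of orthonormal families and injectivity of \<open>comb\<close> come from
  this.\<close>

lemma B_comb_unit:
  assumes "orthonormal e k" "j < k"
  shows "B (comb k e x) (e j) = 2 * x j"
proof -
  have "B (comb k e x) (e j) = (\<Sum>i<k. B (s (x i) (e i)) (e j))"
    unfolding comb_def using assms by (intro B_sum) (auto simp: orthonormal_in)
  also have "\<dots> = (\<Sum>i<k. if i = j then 2 * x j else 0)"
    using assms by (intro sum.cong) (auto simp: orthonormal_B orthonormal_in)
  finally have "B (comb k e x) (e j) = (\<Sum>i<k. if i = j then 2 * x j else 0)" .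
  then show ?thesis using assms by simp
qed

lemma B_comb:
  assumes "orthonormal e k"
  shows "B (comb k e x) (comb k e y) = 2 * (\<Sum>i<k. x i * y i)"
proof -
  have "B (comb k e y) (comb k e x) = (\<Sum>i<k. B (s (y i) (e i)) (comb k e x))"
    unfolding comb_def[of k e y] using assms by (intro B_sum) (auto simp: orthonormal_in)
  also have "\<dots> = (\<Sum>i<k. y i * (2 * x i))"
    using assms by (intro sum.cong) (auto simp: B_comb_unit B_commute[of "e _" "comb _ _ _"] orthonormal_in)
  finally show ?thesis by (subst B_commute) (simp add: sum_distrib_left mult_ac)
qed

lemma Q_comb: "orthonormal e k \<Longrightarrow> Q (comb k e x) = (\<Sum>i<k. x i * x i)"
  using two_nonzero by (simp add: Q_eq B_comb)

lemma orthonormal_independent: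
  assumes "orthonormal e k"
  shows "inj_on e {..<k}" "independent (e ` {..<k})"
proof -
  have *: "\<forall>i<k. x i = 0" if x: "(\<Sum>i<k. s (x i) (e i)) = 0" for x
  proof (intro allI impI)
    fix j assume j: "j < k"
    have "B (comb k e x) (e j) = 0" using assms j x by (simp add: comb_def orthonormal_in)
    then show "x j = 0" using B_comb_unit[OF assms j, of x] two_nonzero by simp
  qed
  show "inj_on e {..<k}" "independent (e ` {..<k})"
    by (rule independent_familyI, erule *)+
qed

lemma comb_in_span: "comb k e x \<in> span (e ` {..<k})"
  unfolding comb_def by (auto intro!: span_sum span_scale intro: span_base)

lemma span_orthonormal:
  assumes "orthonormal e k" "v \<in> span (e ` {..<k})"
  shows "\<exists>x. v = comb k e x"
proof -
  have "span (e ` {..<k}) = range (\<lambda>u. \<Sum>v\<in>e ` {..<k}. s (u v) v)"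
    by (rule span_finite) simp
  with assms(2) obtain u where "v = (\<Sum>v\<in>e ` {..<k}. s (u v) v)" by auto
  then have "v = comb k e (\<lambda>i. u (e i))"
    using orthonormal_independent(1)[OF assms(1)] by (simp add: comb_def sum.reindex)
  then show ?thesis by blast
qed

text \<open>Gram-Schmidt projection to the complement of the family; the coefficients are divided by
  \<open>B (e i) (e i) = 2\<close>.\<close>

definition orthogonal_part :: "nat \<Rightarrow> (nat \<Rightarrow> 'v) \<Rightarrow> 'v \<Rightarrow> 'v" where
  "orthogonal_part k e v = v - comb k e (\<lambda>i. B v (e i) / 2)"

text \<open>By the last clause a vector orthogonal to the family pairs equally with \<open>v\<close>
  and with its projection, so a non-zero pairing survives the passage to the complement.\<close>

lemma orthogonal_part:
  assumes e: "orthonormal e k" and v: "v \<in> V"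
  shows "orthogonal_part k e v \<in> V"
    and "i < k \<Longrightarrow> B (orthogonal_part k e v) (e i) = 0"
    and "v - orthogonal_part k e v \<in> span (e ` {..<k})"
    and "w \<in> V \<Longrightarrow> (\<And>i. i < k \<Longrightarrow> B w (e i) = 0) \<Longrightarrow> B w (orthogonal_part k e v) = B w v"
proof -
  let ?c = "comb k e (\<lambda>i. B v (e i) / 2)"
  show "orthogonal_part k e v \<in> V" using assms by (simp add: orthogonal_part_def)
  show "B (orthogonal_part k e v) (e i) = 0" if "i < k"
    using assms that two_nonzero by (simp add: B_comb_unit orthogonal_part_def orthonormal_in)
  show "v - orthogonal_part k e v \<in> span (e ` {..<k})"
    using comb_in_span by (simp add: orthogonal_part_def)
  show "B w (orthogonal_part k e v) = B w v" if w: "w \<in> V" "\<And>i. i < k \<Longrightarrow> B w (e i) = 0"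
  proof -
    have "B ?c w = 0"
      by (subst comb_def, subst B_sum) (use assms w in \<open>auto simp: B_commute[of "e _" w] orthonormal_in\<close>)
    then show ?thesis using assms w by (simp add: B_commute orthogonal_part_def)
  qed
qed

text \<open>The complement of the family is itself non-degenerate: a non-zero \<open>v'\<close> in
  it pairs non-trivially with some \<open>w\<close>, hence with the projection \<open>w'\<close>. By
  polarisation \<open>Q\<close> cannot vanish at all of \<open>v'\<close>, \<open>w'\<close> and
  \<open>v' + w'\<close>, and one with \<open>Q\<close> non-zero is normalised.\<close>

lemma ex_orthonormal_step:
  assumes e: "orthonormal e k" and v: "v \<in> V" "v \<notin> span (e ` {..<k})"
  shows "\<exists>w. orthonormal (e(k := w)) (Suc k)"
proof -
  define v' where "v' = orthogonal_part k e v"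
  note v' = orthogonal_part(1,2,3)[OF e v(1), folded v'_def]
  have "v' \<noteq> 0" using v v' by auto
  then obtain w where w: "w \<in> V" "B v' w \<noteq> 0" using ex_polar_nonzero v'(1) by blast
  define w' where "w' = orthogonal_part k e w"
  note w' = orthogonal_part[OF e w(1), folded w'_def]
  have "Q (v' + w') = Q v' + Q w' + B v' w" using w'(4)[of v'] v' by (simp add: Q_add)
  then have "Q v' \<noteq> 0 \<or> Q w' \<noteq> 0 \<or> Q (v' + w') \<noteq> 0" using w by auto
  moreover have "B (v' + w') (e i) = 0" if "i < k" for i
    using that v' w'(1,2) by (simp add: orthonormal_in[OF e])
  ultimately obtain u where u: "u \<in> V" "\<forall>i<k. B u (e i) = 0" "Q u \<noteq> 0"
    using v'(1,2) w'(1,2) V_closed(2) by metis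
  obtain c where "B (s c u) (s c u) = 2" by (rule ex_normalize[OF u(1,3)])
  then have "orthonormal (e(k := s c u)) (Suc k)"
    using e u by (intro orthonormal_append) (auto simp: orthonormal_in[OF e])
  then show ?thesis by blast
qed

lemma orthonormal_le_dim:
  assumes "dim V > 0" "orthonormal e k"
  shows "k \<le> dim V"
proof -
  have "e ` {..<k} \<subseteq> V" by (auto simp: orthonormal_in[OF assms(2)])
  from independent_card_le_dim[OF assms(1) orthonormal_independent(2)[OF assms(2)] this]
  show ?thesis using orthonormal_independent(1)[OF assms(2)] by (simp add: card_image)
qed

text \<open>A vector outside the span would prolong the family to \<open>Suc (dim V)\<close>
  independent vectors.\<close>

lemma orthonormal_span:
  assumes "dim V > 0" "orthonormal e (dim V)"
  shows "V = span (e ` {..<dim V})"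
proof
  show "V \<subseteq> span (e ` {..<dim V})"
  proof
    fix v assume "v \<in> V"
    then show "v \<in> span (e ` {..<dim V})"
      using ex_orthonormal_step[OF assms(2)] orthonormal_le_dim[OF assms(1), of _ "Suc (dim V)"]
      by fastforce
  qed
  show "span (e ` {..<dim V}) \<subseteq> V"
    using subspace_V by (intro span_minimal) (auto simp: orthonormal_in[OF assms(2)])
qed

lemma ex_orthonormal_extension:
  assumes "dim V > 0" "orthonormal e k"
  shows "\<exists>e'. orthonormal e' (dim V) \<and> (\<forall>i<k. e' i = e i)"
  using assms
proof (induction "dim V - k" arbitrary: k e)
  case 0
  then have "k = dim V" using orthonormal_le_dim[of e k] by simp
  with 0 show ?case by blast
next
  case (Suc m)
  have "\<not> V \<subseteq> span (e ` {..<k})"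
  proof
    assume "V \<subseteq> span (e ` {..<k})"
    then have "dim V \<le> card (e ` {..<k})" by (rule dim_le_card) simp
    also have "\<dots> \<le> k" using card_image_le[of "{..<k}" e] by simp
    finally show False using Suc by simp
  qed
  then obtain w where w: "orthonormal (e(k := w)) (Suc k)"
    using ex_orthonormal_step[OF Suc(4)] by blast
  have "m = dim V - Suc k" using Suc(2) by simp
  from Suc(1)[OF this Suc(3) w]
  obtain e' where "orthonormal e' (dim V)" "\<forall>i<Suc k. e' i = (e(k := w)) i" by blast
  then show ?case by (intro exI[of _ e']) auto
qed

section \<open>Hyperbolic planes through singular vectors\<close>

text \<open>\<open>p\<close> and \<open>w\<close> span a hyperbolic plane with orthonormal basis
  \<open>a\<close>, \<open>b\<close>. The basis vectors are combinations of \<open>p\<close> and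
  \<open>w\<close> and so inherit every orthogonality that these share; the last conclusion records
  this, and the choice of \<open>w\<close> thereby controls the position of the plane.\<close>

lemma hyperbolic_decomposition:
  assumes V: "p \<in> V" "w \<in> V" and "Q p = 0" and nz: "B p w \<noteq> 0"
  obtains a b where "a \<in> V" "b \<in> V" "B a a = 2" "B b b = 2" "B a b = 0" "p = a + s \<iota> b"
    "\<And>v. v \<in> V \<Longrightarrow> B v p = 0 \<Longrightarrow> B v w = 0 \<Longrightarrow> B v a = 0 \<and> B v b = 0"
proof -
  have pp: "B p p = 0" using assms by (simp add: B_self)
  \<comment> \<open>After scaling, \<open>B p w' = 1\<close>, hence
    \<open>Q (w' - s t p) = Q w' - t\<close>; the choice \<open>t = Q w'\<close> makes the partner
    singular.\<close>
  define w' where "w' = s (1 / B p w) w"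
  define m where "m = w' - s (Q w') p"
  have w': "w' \<in> V" "B p w' = 1" using V nz by (auto simp: w'_def)
  then have w'': "B w' p = 1" by (simp add: B_commute)
  have m: "m \<in> V" "B p m = 1" "B m p = 1" "B m m = 0"
    using V w' w'' pp by (auto simp: m_def B_self[of w'])
  have mv: "B v m = 0" if "v \<in> V" "B v p = 0" "B v w = 0" for v
    using that V w' by (simp add: m_def) (simp add: w'_def)
  \<comment> \<open>With \<open>B p m = 1\<close>, the vectors p/2 + 2m and p/2 - 2m are orthogonal
    of norms 1 and -1. The factor \<open>- \<iota>\<close> turns the second norm into 1 and lets the
    terms in \<open>m\<close> cancel in \<open>a + s \<iota> b\<close>.\<close>
  define a where "a = s (1/2) p + s 2 m"
  define b where "b = s (- \<iota>) (s (1/2) p - s 2 m)"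
  show ?thesis
  proof
    show "a \<in> V" "b \<in> V" using V m by (auto simp: a_def b_def simp del: scale_minus_left)
    show "B a a = 2" "B b b = 2" "B a b = 0"
      using V m pp two_nonzero
      by (simp_all add: a_def b_def algebra_simps del: scale_minus_left scale_scale)
    have "a + s \<iota> b = s (1/2 + 1/2) p" by (simp only: scale_left_distrib) (simp add: a_def b_def)
    also have "(1/2 + 1/2 :: 'k) = 1" using two_nonzero by (simp add: field_simps)
    finally show "p = a + s \<iota> b" by simp
    show "B v a = 0 \<and> B v b = 0" if "v \<in> V" "B v p = 0" "B v w = 0" for v
      using that V m mv[OF that] by (simp add: a_def b_def del: scale_minus_left scale_scale)
  qed
qed

text \<open>Since \<open>l\<close> is orthogonal to the family, a partner of \<open>l\<close> can be
  projected to the complement without changing its pairing with \<open>l\<close>. The plane of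
  \<open>l\<close> and this projection is orthogonal to the family and takes up the two new
  indices.\<close>

lemma orthonormal_append_singular:
  assumes e: "orthonormal e k" and l: "l \<in> V" "l \<noteq> 0" "Q l = 0" "\<And>i. i < k \<Longrightarrow> B l (e i) = 0"
  obtains e' where "orthonormal e' (Suc (Suc k))" "\<And>i. i < k \<Longrightarrow> e' i = e i"
    "l = e' k + s \<iota> (e' (Suc k))"
proof -
  obtain w where w: "w \<in> V" "B l w \<noteq> 0" using ex_polar_nonzero l(1,2) by blast
  define w' where "w' = orthogonal_part k e w"
  note w' = orthogonal_part(1,2)[OF e w(1), folded w'_def]
  have "B l w' \<noteq> 0" using orthogonal_part(4)[OF e w(1) l(1,4)] w by (simp add: w'_def)
  from hyperbolic_decomposition[OF l(1) w'(1) l(3) this]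
  obtain a b where ab: "a \<in> V" "b \<in> V" "B a a = 2" "B b b = 2" "B a b = 0" "l = a + s \<iota> b"
    "\<And>v. v \<in> V \<Longrightarrow> B v l = 0 \<Longrightarrow> B v w' = 0 \<Longrightarrow> B v a = 0 \<and> B v b = 0"
    by metis
  have ort: "B a (e i) = 0" "B b (e i) = 0" if "i < k" for i
    using ab(7)[of "e i"] l(4)[OF that] w'(2)[OF that] orthonormal_in[OF e that] by (auto simp: B_commute)
  have "orthonormal (e(k := a)) (Suc k)"
    by (rule orthonormal_append[OF e ab(1,3) ort(1)])
  moreover have "B b ((e(k := a)) i) = 0" if "i < Suc k" for i
    using that ab(5) ort B_commute[of b a] by (auto simp: less_Suc_eq)
  ultimately have "orthonormal (e(k := a, Suc k := b)) (Suc (Suc k))"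
    using ab(2,4) orthonormal_append[of "e(k := a)" "Suc k" b] by blast
  then show ?thesis by (rule that) (simp_all add: ab(6))
qed

end

subsection \<open>Standard positions of the two points\<close>

definition unit_vec :: "nat \<Rightarrow> nat \<Rightarrow> 'k::field" where
  "unit_vec j = (\<lambda>i. if i = j then 1 else 0)"

definition null_vec :: "nat \<Rightarrow> nat \<Rightarrow> 'k::field" where
  "null_vec j = (\<lambda>i. if i = j then 1 else if i = Suc j then sqrt_minus_one else 0)"

text \<open>Disjoint supports make the vectors of a pair orthogonal; in the pair with equal entries
  a singular vector is orthogonal to itself. In the mixed pairs the null vector starts at index 1 to
  leave index 0 to the unit vector. The last pair fills the indices 0 to 3, hence its bound.\<close>

definition standard_pair :: "nat \<Rightarrow> (nat \<Rightarrow> 'k::field) \<Rightarrow> (nat \<Rightarrow> 'k) \<Rightarrow> bool" where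
  "standard_pair n x y \<longleftrightarrow>
     (x, y) \<in> {(unit_vec 0, unit_vec 1), (unit_vec 0, null_vec 1), (null_vec 1, unit_vec 0),
       (null_vec 0, null_vec 0)} \<or> n \<ge> 4 \<and> (x, y) = (null_vec 0, null_vec 2)"

lemma standard_pair_intros:
  "standard_pair n (unit_vec 0) (unit_vec 1)"
  "standard_pair n (unit_vec 0) (null_vec 1)"
  "standard_pair n (null_vec 1) (unit_vec 0)"
  "standard_pair n (null_vec 0) (null_vec 0)"
  "n \<ge> 4 \<Longrightarrow> standard_pair n (null_vec 0) (null_vec 2)"
  by (auto simp: standard_pair_def)

lemma sum_unit_vec: "j < n \<Longrightarrow> (\<Sum>i<n. x i * unit_vec j i) = x j"
proof -
  assume "j < n"
  have "(\<Sum>i<n. x i * unit_vec j i) = (\<Sum>i<n. if i = j then x j else 0)"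
    by (intro sum.cong) (auto simp: unit_vec_def)
  then show ?thesis using \<open>j < n\<close> by simp
qed

lemma sum_null_vec:
  "Suc j < n \<Longrightarrow> (\<Sum>i<n. x i * null_vec j i) = x j + x (Suc j) * sqrt_minus_one"
proof -
  assume j: "Suc j < n"
  have "(\<Sum>i<n. x i * null_vec j i) =
      (\<Sum>i<n. (if i = j then x j else 0) + (if i = Suc j then x (Suc j) * sqrt_minus_one else 0))"
    by (intro sum.cong) (auto simp: null_vec_def)
  then show ?thesis using j by (simp add: sum.distrib)
qed

context regular_quadratic_space
begin

lemma comb_unit_vec: "j < k \<Longrightarrow> comb k e (unit_vec j) = e j"
proof -
  assume "j < k"
  have "comb k e (unit_vec j) = (\<Sum>i<k. if i = j then e j else 0)"
    unfolding comb_def by (intro sum.cong) (auto simp: unit_vec_def)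
  then show ?thesis using \<open>j < k\<close> by simp
qed

lemma comb_null_vec: "Suc j < k \<Longrightarrow> comb k e (null_vec j) = e j + s \<iota> (e (Suc j))"
proof -
  assume j: "Suc j < k"
  have "comb k e (null_vec j) =
      (\<Sum>i<k. (if i = j then e j else 0) + (if i = Suc j then s \<iota> (e (Suc j)) else 0))"
    unfolding comb_def by (intro sum.cong) (auto simp: null_vec_def)
  then show ?thesis using j by (simp add: sum.distrib)
qed

lemma orthonormal_one: "v \<in> V \<Longrightarrow> B v v = 2 \<Longrightarrow> orthonormal (\<lambda>_. v) 1"
  by (simp add: orthonormal_def)

text \<open>A scaled \<open>p\<close> opens the basis, and \<open>l\<close> lies in its complement,
  where it fills index 1 if \<open>Q l\<close> is non-zero and the indices 1 and 2 otherwise. Only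
  \<open>p\<close> has to be non-singular, so the lemma also serves with the two points
  exchanged.\<close>

lemma ex_standard_basis_regular:
  assumes n: "dim V = n" "n \<ge> 3" and p: "p \<in> V" "Q p \<noteq> 0" and l: "l \<in> V" "l \<noteq> 0" and pl: "B p l = 0"
  shows "\<exists>e y. orthonormal e n \<and> y \<in> {unit_vec 1, null_vec 1} \<and>
    span {p} = span {comb n e (unit_vec 0)} \<and> span {l} = span {comb n e y}"
proof -
  have pos: "dim V > 0" using n by simp
  obtain c where c: "c \<noteq> 0" "B (s c p) (s c p) = 2" by (rule ex_normalize[OF p])
  note p1 = orthonormal_one[OF V_closed(4)[OF p(1)] c(2)]
  show ?thesis
  proof (cases "Q l = 0")
    case False
    obtain c' where c': "c' \<noteq> 0" "B (s c' l) (s c' l) = 2" by (rule ex_normalize[OF l(1) False])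
    have "B (s c' l) (s c p) = 0" using p l pl by (simp add: B_commute)
    then have "orthonormal ((\<lambda>_. s c p)(1 := s c' l)) (Suc 1)"
      using l by (intro orthonormal_append[OF p1 _ c'(2)]) auto
    then obtain e where e: "orthonormal e n" "\<forall>i<Suc 1. e i = ((\<lambda>_. s c p)(1 := s c' l)) i"
      using ex_orthonormal_extension[OF pos] unfolding n(1) by blast
    then have "e 0 = s c p" "e 1 = s c' l" by simp_all
    then have "span {p} = span {comb n e (unit_vec 0)}" "span {l} = span {comb n e (unit_vec 1)}"
      using n c(1) c'(1) by (simp_all add: comb_unit_vec span_scale_singleton)
    then show ?thesis using e(1) by blast
  next
    case True
    have "B l (s c p) = 0" using p l pl by (simp add: B_commute)
    then obtain e' where e': "orthonormal e' (Suc (Suc 1))" "\<And>i. i < 1 \<Longrightarrow> e' i = s c p"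
      "l = e' 1 + s \<iota> (e' (Suc 1))"
      by (rule orthonormal_append_singular[OF p1 l True]) blast+
    then obtain e where e: "orthonormal e n" "\<forall>i<Suc (Suc 1). e i = e' i"
      using ex_orthonormal_extension[OF pos] unfolding n(1) by blast
    then have "e 0 = s c p" "e 1 = e' 1" "e (Suc 1) = e' (Suc 1)" using e'(2)[of 0] by simp_all
    then have "span {p} = span {comb n e (unit_vec 0)}" "span {l} = span {comb n e (null_vec 1)}"
      using n c(1) e'(3) by (simp_all add: comb_unit_vec comb_null_vec span_scale_singleton)
    then show ?thesis using e(1) by blast
  qed
qed

text \<open>Non-degeneracy makes the functionals \<open>B p\<close> and \<open>B l\<close>
  independent whenever \<open>p\<close> and \<open>l\<close> are, so one can vanish where the other
  does not. If \<open>l\<close> is orthogonal to \<open>p\<close>, such a \<open>w\<close> puts the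
  plane of \<open>p\<close> into the complement of \<open>l\<close>.\<close>

lemma ex_hyperbolic_partner:
  assumes p: "p \<in> V" "p \<noteq> 0" and l: "l \<in> V" "l \<notin> span {p}"
  shows "\<exists>w\<in>V. B p w \<noteq> 0 \<and> B l w = 0"
proof -
  obtain u where u: "u \<in> V" "B p u \<noteq> 0" using ex_polar_nonzero p by blast
  define w where "w = s (1 / B p u) u"
  have w: "w \<in> V" "B p w = 1" using u p by (auto simp: w_def)
  define l' where "l' = l - s (B l w) p"
  have "l' \<in> V" "l' \<noteq> 0" using l p by (auto simp: l'_def span_singleton)
  then obtain v where v: "v \<in> V" "B l' v \<noteq> 0" using ex_polar_nonzero by blast
  have l'w: "B l' w = 0" using w p l by (simp add: l'_def)
  \<comment> \<open>Subtracting the multiple of \<open>w\<close> gives orthogonality to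
    \<open>p\<close>, and \<open>B l' w = 0\<close> keeps the pairing with \<open>l'\<close>. Adding
    multiples of \<open>v'\<close> to \<open>w\<close> then changes \<open>B l w\<close> but not
    \<open>B p w\<close>.\<close>
  define v' where "v' = v - s (B p v) w"
  have v': "v' \<in> V" "B p v' = 0" "B l' v' \<noteq> 0"
    using v w l'w p \<open>l' \<in> V\<close> by (auto simp: v'_def)
  have lv': "B l v' \<noteq> 0" using v' p l by (simp add: l'_def)
  let ?w = "w - s (B l w / B l v') v'"
  have "?w \<in> V" "B p ?w \<noteq> 0" "B l ?w = 0" using w v' lv' p l by auto
  then show ?thesis by blast
qed

lemma ex_standard_basis:
  assumes n: "dim V = n" "n \<ge> 3" and p: "p \<in> V" "p \<noteq> 0" and l: "l \<in> V" "l \<noteq> 0" and pl: "B p l = 0"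
  shows "\<exists>e x y. orthonormal e n \<and> standard_pair n x y \<and>
    span {p} = span {comb n e x} \<and> span {l} = span {comb n e y}"
proof -
  have pos: "dim V > 0" using n by simp
  consider "Q p \<noteq> 0" | "Q l \<noteq> 0" "Q p = 0" | "Q p = 0" "Q l = 0" by blast
  then show ?thesis
  proof cases
    case 1
    from ex_standard_basis_regular[OF n p(1) 1 l pl] show ?thesis
      unfolding standard_pair_def by blast
  next
    case 2
    have "B l p = 0" using pl by (simp add: B_commute)
    from ex_standard_basis_regular[OF n l(1) 2(1) p this]
    obtain e y where e: "orthonormal e n" "y \<in> {unit_vec 1, null_vec 1}"
      "span {l} = span {comb n e (unit_vec 0)}" "span {p} = span {comb n e y}" by blast
    \<comment> \<open>Otherwise the singular \<open>p\<close> would be a non-zero multiple of a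
      vector of norm 1.\<close>
    have "y \<noteq> unit_vec 1"
    proof
      assume "y = unit_vec 1"
      then have "p \<in> span {e 1}" using e(4) n span_base[of p "{p}"] by (simp add: comb_unit_vec)
      then obtain c where "p = s c (e 1)" by (auto simp: span_singleton)
      moreover have "Q (e 1) = 1" "e 1 \<in> V"
        using n e(1) two_nonzero by (auto simp: Q_eq orthonormal_in orthonormal_B)
      ultimately show False using 2 p by (auto simp: Q_scale)
    qed
    then show ?thesis using e unfolding standard_pair_def by blast
  next
    case 3
    show ?thesis
    proof (cases "l \<in> span {p}")
      case True
      then obtain c where c: "l = s c p" by (auto simp: span_singleton)
      with l have "c \<noteq> 0" by auto
      then have lp: "span {l} = span {p}" using c by (simp add: span_scale_singleton)
      \<comment> \<open>A placeholder for the empty family: the plane of \<open>p\<close> then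
        occupies the indices 0 and 1.\<close>
      have "orthonormal (\<lambda>_. p) 0" by (simp add: orthonormal_def)
      then obtain e' where e': "orthonormal e' (Suc (Suc 0))" "p = e' 0 + s \<iota> (e' (Suc 0))"
        by (rule orthonormal_append_singular[OF _ p 3(1)]) auto
      then obtain e where e: "orthonormal e n" "\<forall>i<Suc (Suc 0). e i = e' i"
        using ex_orthonormal_extension[OF pos] unfolding n(1) by blast
      then have "e 0 = e' 0" "e (Suc 0) = e' (Suc 0)" by simp_all
      then have "span {p} = span {comb n e (null_vec 0)}" using n e'(2) by (simp add: comb_null_vec)
      then show ?thesis using e(1) lp unfolding standard_pair_def by blast
    next
      case False
      obtain w where w: "w \<in> V" "B p w \<noteq> 0" "B l w = 0"
        using ex_hyperbolic_partner[OF p l(1) False] by blast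
      obtain a b where ab: "a \<in> V" "b \<in> V" "B a a = 2" "B b b = 2" "B a b = 0" "p = a + s \<iota> b"
        and orth: "\<And>v. v \<in> V \<Longrightarrow> B v p = 0 \<Longrightarrow> B v w = 0 \<Longrightarrow> B v a = 0 \<and> B v b = 0"
        using hyperbolic_decomposition[OF p(1) w(1) 3(1) w(2)] by blast
      have "B l p = 0" using pl by (simp add: B_commute)
      then have lab: "B l a = 0" "B l b = 0" using orth[OF l(1)] w by auto
      have "B b a = 0" using ab by (simp add: B_commute)
      then have ab2: "orthonormal ((\<lambda>_. a)(1 := b)) (Suc 1)"
        using orthonormal_append[OF orthonormal_one[OF ab(1,3)] ab(2,4)] by simp
      have "B l (((\<lambda>_. a)(1 := b)) i) = 0" for i using lab by simp
      then obtain e' where e': "orthonormal e' (Suc (Suc (Suc 1)))"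
        "\<And>i. i < Suc 1 \<Longrightarrow> e' i = ((\<lambda>_. a)(1 := b)) i" "l = e' (Suc 1) + s \<iota> (e' (Suc (Suc 1)))"
        by (rule orthonormal_append_singular[OF ab2 l 3(2)]) blast+
      then obtain e where e: "orthonormal e n" "\<forall>i<Suc (Suc (Suc 1)). e i = e' i"
        using ex_orthonormal_extension[OF pos] unfolding n(1) by blast
      \<comment> \<open>Two orthonormal vectors for each singular point: distinct orthogonal
        singular points exist only from dimension 4 on.\<close>
      have "n \<ge> 4" using orthonormal_le_dim[OF pos e'(1)] n by simp
      moreover have "e 0 = a" "e 1 = b" "e 2 = e' (Suc 1)" "e 3 = e' (Suc (Suc 1))"
        using e(2) e'(2)[of 0] e'(2)[of 1] by (simp_all add: numeral_2_eq_2 numeral_3_eq_3)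
      ultimately have "span {p} = span {comb n e (null_vec 0)}" "span {l} = span {comb n e (null_vec 2)}"
        using ab(6) e'(3) by (simp_all add: comb_null_vec)
      then show ?thesis using e(1) \<open>n \<ge> 4\<close> unfolding standard_pair_def by blast
    qed
  qed
qed

section \<open>Symplectic subspaces\<close>

lemma ex_symplectic_subspace:
  assumes e: "orthonormal e n" and m: "2 * m \<le> n"
  shows "\<exists>W\<subseteq>V. symplectic_subspace s Q m W"
proof -
  \<comment> \<open>The singular vectors e + \<iota> e' and e - \<iota> e' of a coordinate plane
    have pairing 4, hence the factor 1/4. The coordinates of a combination with respect to
    \<open>e\<close> are given by \<open>y x\<close>; its norm on one plane is the difference of the
    squares of u + v/4 and u - v/4, which is u v.\<close>
  define b where "b i = (if even i then e i + s \<iota> (e (Suc i))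
    else s (1 / 4) (e (i - 1) - s \<iota> (e i)))" for i
  define y where "y x i = (if even i then x i + x (Suc i) / 4
    else \<iota> * (x (i - 1) - x i / 4))" for x :: "nat \<Rightarrow> 'k" and i
  have om: "orthonormal e (2 * m)" using e m by (simp add: orthonormal_def)
  have sum: "(\<Sum>i<2 * k. s (x i) (b i)) = comb (2 * k) e (y x)" for x k
  proof (induction k)
    case (Suc k)
    have "s (x (2 * k)) (b (2 * k)) + s (x (Suc (2 * k))) (b (Suc (2 * k))) =
        s (y x (2 * k)) (e (2 * k)) + s (y x (Suc (2 * k))) (e (Suc (2 * k)))"
      by (simp add: b_def y_def algebra_simps)
    with Suc show ?case by (simp add: comb_def add.assoc)
  qed (simp add: comb_def)
  have squares: "y x (2 * j) * y x (2 * j) + y x (Suc (2 * j)) * y x (Suc (2 * j)) =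
      x (2 * j) * x (2 * j + 1)" for x j
  proof -
    have "\<iota> * a * (\<iota> * a) = - (a * a)" for a by (simp add: mult_ac)
    then have "y x (2 * j) * y x (2 * j) + y x (Suc (2 * j)) * y x (Suc (2 * j)) =
        4 * (x (2 * j) * (x (Suc (2 * j)) / 4))"
      by (simp add: y_def algebra_simps)
    then show ?thesis using four_nonzero by simp
  qed
  have "Q (\<Sum>i<2 * m. s (x i) (b i)) = (\<Sum>j<m. x (2 * j) * x (2 * j + 1))" for x
  proof -
    have "(\<Sum>i<2 * k. y x i * y x i) = (\<Sum>j<k. x (2 * j) * x (2 * j + 1))" for k
    proof (induction k)
      case (Suc k)
      then show ?case using squares[of x k] by (simp add: add.assoc)
    qed simp
    then show ?thesis by (simp only: sum Q_comb[OF om])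
  qed
  moreover have "inj_on b {..<2 * m}" "independent (b ` {..<2 * m})"
  proof -
    have "\<forall>i<2 * m. x i = 0" if x: "(\<Sum>i<2 * m. s (x i) (b i)) = 0" for x
    proof -
      have y0: "y x i = 0" if "i < 2 * m" for i
        using B_comb_unit[OF om that, of "y x"] x sum[of x m] two_nonzero orthonormal_in[OF om that]
        by simp
      have "x (2 * j) = 0 \<and> x (Suc (2 * j)) = 0" if "j < m" for j
      proof -
        have eq: "x (2 * j) + x (Suc (2 * j)) / 4 = 0" "x (2 * j) - x (Suc (2 * j)) / 4 = 0"
          using y0[of "2 * j"] y0[of "Suc (2 * j)"] that by (auto simp: y_def)
        have "2 * x (2 * j) = (x (2 * j) + x (Suc (2 * j)) / 4) + (x (2 * j) - x (Suc (2 * j)) / 4)"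
          by simp
        then have "2 * x (2 * j) = 0" unfolding eq by simp
        then show ?thesis using eq two_nonzero four_nonzero by simp
      qed
      note * = this
      show ?thesis
      proof (intro allI impI)
        fix i assume "i < 2 * m"
        then have "i div 2 < m" "i = 2 * (i div 2) \<or> i = Suc (2 * (i div 2))" by linarith+
        then show "x i = 0" using *[of "i div 2"] by metis
      qed
    qed
    from independent_familyI[OF this] show "inj_on b {..<2 * m}" "independent (b ` {..<2 * m})" by auto
  qed
  moreover have "span (b ` {..<2 * m}) \<subseteq> V"
  proof (rule span_minimal)
    have "b i \<in> V" if "i < 2 * m" for i
    proof (cases "even i")
      case True
      then have "Suc i < 2 * m" using that by presburger
      then show ?thesis using True that by (simp add: b_def orthonormal_in[OF om])
    qed (use that in \<open>simp add: b_def orthonormal_in[OF om]\<close>)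
    then show "b ` {..<2 * m} \<subseteq> V" by blast
  qed (rule subspace_V)
  ultimately show ?thesis
    unfolding symplectic_subspace_def by (intro exI[of _ "span (b ` {..<2 * m})"] exI[of _ b] conjI) simp_all
qed

lemma symplectic_subspace_le_dim:
  assumes "dim V > 0" "symplectic_subspace s Q m W" "W \<subseteq> V"
  shows "2 * m \<le> dim V"
proof -
  from assms(2) obtain b where b: "inj_on b {..<2 * m}" "independent (b ` {..<2 * m})"
    "span (b ` {..<2 * m}) = W" unfolding symplectic_subspace_def by (elim exE conjE)
  have "b ` {..<2 * m} \<subseteq> V" using b(3) assms(3) span_superset[of "b ` {..<2 * m}"] by simp
  from independent_card_le_dim[OF assms(1) b(2) this] show ?thesis
    using b(1) by (simp add: card_image)
qed

section \<open>Non-degeneracy and norms through representatives\<close>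

lemma orthogonal_points_span:
  assumes "u \<in> V" "v \<in> V"
  shows "orthogonal_points Q (span {u}) (span {v}) \<longleftrightarrow> B u v = 0"
proof
  assume "orthogonal_points Q (span {u}) (span {v})"
  then show "B u v = 0" unfolding orthogonal_points_def by (simp add: span_base)
next
  assume "B u v = 0"
  then show "orthogonal_points Q (span {u}) (span {v})"
    using assms by (auto simp: orthogonal_points_def span_singleton)
qed

text \<open>The two inequalities do double duty: they make the point and the hyperplane non-ideal,
  and they show that \<open>p\<close> and \<open>h\<close> are non-zero and so represent projective
  points.\<close>

lemma nondegenerate_geometryI:
  assumes G: "space G = V" "form G = Q" "ptP G = span {u}" "ptL G = span {w}"
    and V: "u \<in> V" "w \<in> V" "p \<in> V" "h \<in> V"
    and p: "B p p = 0" "B u p = 0" "B w p \<noteq> 0"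
    and h: "B h h = 0" "B w h = 0" "B u h \<noteq> 0"
    and ph: "B p h = 0"
  shows "nondegenerate_geometry s G"
proof -
  have hyp: "hypercycle s G (span {v})" if "v \<in> V" "B v v = 0" "v \<noteq> 0" for v
    using that unfolding hypercycle_def projective_points_def G
    by (auto simp: span_singleton Q_scale Q_eq[of v])
  have "p \<noteq> 0" "h \<noteq> 0" using V p h by auto
  then show ?thesis
    using hyp[of p] hyp[of h] V p h ph
    unfolding nondegenerate_geometry_def is_ideal_def is_point_def is_hyperplane_def
    by (intro exI[of _ "span {p}"] exI[of _ "span {h}"]) (simp add: G orthogonal_points_span)
qed

text \<open>The first four basis vectors split into two orthogonal planes, one containing
  \<open>P\<close> and one containing \<open>L\<close>: indices 1, 2 and 0, 3 in the first three
  cases, 0, 1 and 2, 3 in the last. A singular vector in the plane of \<open>L\<close> is orthogonal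
  to \<open>P\<close> and gives the point; the plane of \<open>P\<close> gives the
  hyperplane.\<close>

lemma nondegenerate_geometry_standard:
  assumes G: "space G = V" "form G = Q" "ptP G = span {comb n e x}" "ptL G = span {comb n e y}"
    and e: "orthonormal e n" and n: "n \<ge> 4" and xy: "standard_pair n x y" "x \<noteq> y"
  shows "nondegenerate_geometry s G"
proof -
  note I = nondegenerate_geometryI[OF G comb_in[OF e] comb_in[OF e]]
  have eV: "e 0 \<in> V" "e 1 \<in> V" "e 2 \<in> V" "e 3 \<in> V" using n by (auto intro: orthonormal_in[OF e])
  have eB: "i < 4 \<Longrightarrow> j < 4 \<Longrightarrow> B (e i) (e j) = (if i = j then 2 else 0)" for i j
    using n by (intro orthonormal_B[OF e]) auto
  have c: "comb n e (unit_vec 0) = e 0" "comb n e (unit_vec 1) = e 1"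
    "comb n e (null_vec 0) = e 0 + s \<iota> (e 1)" "comb n e (null_vec 1) = e 1 + s \<iota> (e 2)"
    "comb n e (null_vec 2) = e 2 + s \<iota> (e 3)"
    using n by (simp_all add: comb_unit_vec comb_null_vec numeral_2_eq_2 numeral_3_eq_3)
  consider "x = unit_vec 0" "y = unit_vec 1" | "x = unit_vec 0" "y = null_vec 1"
    | "x = null_vec 1" "y = unit_vec 0" | "x = null_vec 0" "y = null_vec 2"
    using xy by (auto simp: standard_pair_def)
  then show ?thesis
  proof cases
    case 1
    show ?thesis
      by (rule I[of "e 1 + s \<iota> (e 2)" "e 0 + s \<iota> (e 3)"])
        (simp_all add: 1 c eV eB two_nonzero del: One_nat_def)
  next
    case 2
    \<comment> \<open>The vector \<open>e 1 + s \<iota> (e 2)\<close> now spans \<open>L\<close> and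
      is orthogonal to itself, so its conjugate is used; their pairing is 4.\<close>
    show ?thesis
      by (rule I[of "e 1 - s \<iota> (e 2)" "e 0 + s \<iota> (e 3)"])
        (simp_all add: 2 c eV eB two_nonzero four_nonzero del: One_nat_def)
  next
    case 3
    show ?thesis
      by (rule I[of "e 0 + s \<iota> (e 3)" "e 1 - s \<iota> (e 2)"])
        (simp_all add: 3 c eV eB two_nonzero four_nonzero del: One_nat_def)
  next
    case 4
    show ?thesis
      by (rule I[of "e 2 - s \<iota> (e 3)" "e 0 - s \<iota> (e 1)"])
        (simp_all add: 4 c eV eB two_nonzero four_nonzero del: One_nat_def)
  qed
qed

text \<open>In a quadratically closed field the non-zero elements form one square class, and whether
  \<open>Q\<close> vanishes is the same for all representatives; the union defining the norm thus
  runs over a constant family.\<close>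

lemma point_norm_span:
  assumes "v \<in> V" "v \<noteq> 0"
  shows "point_norm Q (span {v}) = (if Q v = 0 then square_class 0 else square_class 1)"
proof -
  have sc: "square_class a = square_class 1" if "a \<noteq> 0" for a :: 'k
  proof -
    have "\<exists>c. c \<noteq> 0 \<and> z = a * c\<^sup>2" if "z \<noteq> 0" "a \<noteq> 0" for a z :: 'k
    proof -
      obtain c where "z / a = c\<^sup>2"
        using quadratically_closed unfolding quadratically_closed_def by blast
      then show ?thesis using that by (intro exI[of _ c]) (auto simp: field_simps)
    qed
    then have "square_class a = UNIV - {0}" if "a \<noteq> 0" for a :: 'k
      using that unfolding square_class_def by auto
    then show ?thesis using that by simp
  qed
  have Qc: "square_class (Q w) = (if Q v = 0 then square_class 0 else square_class 1)"
    if w: "w \<in> span {v} - {0}" for w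
  proof -
    obtain c where "w = s c v" "c \<noteq> 0" using w by (auto simp: span_singleton)
    then have "Q w = 0 \<longleftrightarrow> Q v = 0" using assms by (simp add: Q_scale)
    then show ?thesis using sc[of "Q w"] by (cases "Q v = 0") simp_all
  qed
  have "v \<in> span {v} - {0}" using assms span_base[of v "{v}"] by simp
  then have nonempty: "span {v} - {0} \<noteq> {}" by blast
  have "point_norm Q (span {v}) =
      (\<Union>w\<in>span {v} - {0}. if Q v = 0 then square_class 0 else square_class 1)"
    unfolding point_norm_def by (rule SUP_cong[OF refl Qc])
  also have "\<dots> = (if Q v = 0 then square_class 0 else square_class 1)"
    using nonempty by (simp only: UN_constant if_False)
  finally show ?thesis .
qed

end

subsection \<open>Coordinate models\<close>

definition coord_space :: "nat \<Rightarrow> (nat \<Rightarrow> 'k::field) set" where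
  "coord_space n = {x. \<forall>i\<ge>n. x i = 0}"

definition sum_squares :: "nat \<Rightarrow> (nat \<Rightarrow> 'k::field) \<Rightarrow> 'k" where
  "sum_squares n x = (\<Sum>i<n. x i * x i)"

lemma vector_space_seq_scale: "vector_space (seq_scale :: 'k::field \<Rightarrow> (nat \<Rightarrow> 'k) \<Rightarrow> _)"
  by unfold_locales (auto simp: seq_scale_def plus_fun_def algebra_simps)

lemma subspace_coord_space: "module.subspace seq_scale (coord_space n :: (nat \<Rightarrow> 'k::field) set)"
proof -
  interpret vector_space "seq_scale :: 'k \<Rightarrow> (nat \<Rightarrow> 'k) \<Rightarrow> _" by (rule vector_space_seq_scale)
  show ?thesis
    by (rule subspaceI) (auto simp: coord_space_def seq_scale_def)
qed

lemma polar_sum_squares: "polar (sum_squares n) x y = 2 * (\<Sum>i<n. x i * y i)"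
  by (simp add: polar_def sum_squares_def algebra_simps sum.distrib sum_distrib_left flip: sum_subtractf)

lemma sum_squares_unit_vec: "j < n \<Longrightarrow> sum_squares n (unit_vec j) = 1"
  by (simp add: sum_squares_def sum_unit_vec) (simp add: unit_vec_def)

lemma polar_sum_squares_unit_vec: "j < n \<Longrightarrow> polar (sum_squares n) x (unit_vec j) = 2 * x j"
  by (simp add: polar_sum_squares sum_unit_vec)

lemma polar_sum_squares_null_vec:
  "Suc j < n \<Longrightarrow> polar (sum_squares n) x (null_vec j) = 2 * (x j + x (Suc j) * sqrt_minus_one)"
  by (simp add: polar_sum_squares sum_null_vec)

lemma unit_vec_in: "j < n \<Longrightarrow> unit_vec j \<in> coord_space n"
  by (simp add: coord_space_def unit_vec_def)

lemma null_vec_in: "Suc j < n \<Longrightarrow> null_vec j \<in> coord_space n"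
  by (simp add: coord_space_def null_vec_def)

lemma unit_vec_nonzero: "unit_vec j \<noteq> 0"
  by (auto simp: unit_vec_def fun_eq_iff)

lemma null_vec_nonzero: "null_vec j \<noteq> 0"
  by (auto simp: null_vec_def fun_eq_iff intro!: exI[of _ j])

text \<open>Makes the abstract theory applicable to the models themselves. Non-degeneracy is tested
  on unit vectors, which isolate single coordinates.\<close>

lemma regular_quadratic_space_coord:
  assumes "quadratically_closed TYPE('k::field)" "(2::'k) \<noteq> 0"
  shows "regular_quadratic_space seq_scale (coord_space n) (sum_squares n :: _ \<Rightarrow> 'k)"
proof (intro regular_quadratic_space.intro regular_quadratic_space_axioms.intro)
  show "vector_space (seq_scale :: 'k \<Rightarrow> (nat \<Rightarrow> 'k) \<Rightarrow> _)" by (rule vector_space_seq_scale)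
  show "quadratic_form_on seq_scale (coord_space n) (sum_squares n :: _ \<Rightarrow> 'k)"
    unfolding quadratic_form_on_def bilinear_form_on_def polar_sum_squares
    by (auto simp: sum_squares_def seq_scale_def power2_eq_square algebra_simps sum.distrib
        sum_distrib_left)
  show "nondegenerate_bilinear_on (coord_space n) (polar (sum_squares n :: _ \<Rightarrow> 'k))"
    unfolding nondegenerate_bilinear_on_def
  proof (intro ballI impI)
    fix x :: "nat \<Rightarrow> 'k"
    assume x: "x \<in> coord_space n" "\<forall>v\<in>coord_space n. polar (sum_squares n) x v = 0"
    have "x i = 0" for i
    proof (cases "i < n")
      case True
      then have "2 * x i = 0" using x(2) unit_vec_in polar_sum_squares_unit_vec by metis
      then show ?thesis using assms by simp
    qed (use x in \<open>simp add: coord_space_def\<close>)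
    then show "x = 0" by (simp add: fun_eq_iff)
  qed
qed (use assms subspace_coord_space in auto)

lemma sum_fun_apply: "(\<Sum>i\<in>A. f i) j = (\<Sum>i\<in>A. f i j)"
  by (induction A rule: infinite_finite_induct) auto

lemma dim_coord_space: "vector_space.dim seq_scale (coord_space n :: (nat \<Rightarrow> 'k::field) set) = n"
proof -
  interpret vector_space "seq_scale :: 'k \<Rightarrow> (nat \<Rightarrow> 'k) \<Rightarrow> _" by (rule vector_space_seq_scale)
  have coords: "(\<Sum>i<n. seq_scale (x i) (unit_vec i)) j = (if j < n then x j else 0)" for x :: "nat \<Rightarrow> 'k" and j
  proof -
    have "(\<Sum>i<n. seq_scale (x i) (unit_vec i)) j = (\<Sum>i<n. if i = j then x j else 0)"
      unfolding sum_fun_apply by (intro sum.cong) (auto simp: seq_scale_def unit_vec_def)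
    then show ?thesis by simp
  qed
  have "\<forall>i<n. x i = 0" if "(\<Sum>i<n. seq_scale (x i) (unit_vec i)) = 0" for x :: "nat \<Rightarrow> 'k"
    using coords[of x] unfolding that by (metis zero_fun_apply)
  note basis = independent_familyI[OF this]
  have "x \<in> span (unit_vec ` {..<n})" if "x \<in> coord_space n" for x :: "nat \<Rightarrow> 'k"
  proof -
    have "x = (\<Sum>i<n. seq_scale (x i) (unit_vec i))"
      using that by (auto simp: fun_eq_iff coords coord_space_def)
    also have "\<dots> \<in> span (unit_vec ` {..<n})"
      by (intro span_sum span_scale span_base) auto
    finally show ?thesis .
  qed
  then have "dim (coord_space n :: (nat \<Rightarrow> 'k) set) = card ((unit_vec :: nat \<Rightarrow> nat \<Rightarrow> 'k) ` {..<n})"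
    using basis(2) unit_vec_in by (intro dim_unique[of "unit_vec ` {..<n}"]) auto
  then show ?thesis by (simp add: card_image[OF basis(1)])
qed

section \<open>Composition and inversion of isometries and isomorphisms\<close>

lemma linear_iso_on_trans:
  assumes "linear_iso_on s t U V f" "linear_iso_on t r V W g"
  shows "linear_iso_on s r U W (g \<circ> f)"
proof -
  have "f u \<in> V" if "u \<in> U" for u
    using assms(1) that by (auto simp: linear_iso_on_def bij_betw_def)
  then show ?thesis using assms unfolding linear_iso_on_def by (auto intro: bij_betw_trans)
qed

text \<open>\<open>f\<close> is constrained only on \<open>U\<close>; since \<open>U\<close> is a
  subspace, \<open>x + y\<close> and \<open>s a x\<close> lie in it and are the preimages
  sought.\<close>

lemma linear_iso_on_inv:
  assumes "vector_space s" "module.subspace s U" "linear_iso_on s t U V f"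
  shows "linear_iso_on t s V U (inv_into U f)"
proof -
  interpret vector_space s by fact
  have bij: "bij_betw f U V" using assms(3) by (simp add: linear_iso_on_def)
  have inj: "inv_into U f (f u) = u" if "u \<in> U" for u
    using bij that by (simp add: bij_betw_inv_into_left)
  have img: "\<exists>u\<in>U. v = f u" if "v \<in> V" for v
    using bij that unfolding bij_betw_def by auto
  have "inv_into U f (v + w) = inv_into U f v + inv_into U f w" if vw: "v \<in> V" "w \<in> V" for v w
  proof -
    obtain x y where xy: "x \<in> U" "v = f x" "y \<in> U" "w = f y" using img vw by meson
    then have "v + w = f (x + y)" using assms(3) by (simp add: linear_iso_on_def)
    then show ?thesis using xy subspace_add[OF assms(2)] by (simp add: inj)
  qed
  moreover have "inv_into U f (t a v) = s a (inv_into U f v)" if v: "v \<in> V" for a v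
  proof -
    obtain x where x: "x \<in> U" "v = f x" using img v by meson
    then have "t a v = f (s a x)" using assms(3) by (simp add: linear_iso_on_def)
    then show ?thesis using x subspace_scale[OF assms(2)] by (simp add: inj)
  qed
  ultimately show ?thesis
    using bij_betw_inv_into[OF bij] by (simp add: linear_iso_on_def)
qed

lemma linear_iso_on_image_span_singleton:
  assumes "vector_space s" "vector_space t" "linear_iso_on s t U V f" "u \<in> U"
  shows "f ` module.span s {u} = module.span t {f u}"
proof -
  interpret S: vector_space s by fact
  interpret T: vector_space t by fact
  show ?thesis using assms(3,4)
    by (simp add: S.span_singleton T.span_singleton image_image linear_iso_on_def)
qed

lemma isometric_forms_sym:
  assumes "vector_space s" "module.subspace s U" "isometric_forms s t U Q V R"
  shows "isometric_forms t s V R U Q"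
proof -
  obtain f where f: "linear_iso_on s t U V f" "\<forall>u\<in>U. R (f u) = Q u"
    using assms(3) by (auto simp: isometric_forms_def)
  have "f ` U = V" using f(1) by (auto simp: linear_iso_on_def bij_betw_def)
  then have "\<forall>v\<in>V. Q (inv_into U f v) = R v"
    using f(2) inv_into_into[of _ f U] f_inv_into_f[of _ f U] by metis
  then show ?thesis using linear_iso_on_inv[OF assms(1,2) f(1)] by (auto simp: isometric_forms_def)
qed

lemma isometric_forms_trans:
  assumes "isometric_forms s t U Q V R" "isometric_forms t r V R W S"
  shows "isometric_forms s r U Q W S"
proof -
  obtain f where f: "linear_iso_on s t U V f" "\<forall>u\<in>U. R (f u) = Q u"
    using assms(1) by (auto simp: isometric_forms_def)
  obtain g where g: "linear_iso_on t r V W g" "\<forall>v\<in>V. S (g v) = R v"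
    using assms(2) by (auto simp: isometric_forms_def)
  have "f ` U = V" using f(1) by (auto simp: linear_iso_on_def bij_betw_def)
  then have "\<forall>u\<in>U. S ((g \<circ> f) u) = Q u" using f(2) g(2) by auto
  then show ?thesis using linear_iso_on_trans[OF f(1) g(1)] unfolding isometric_forms_def by blast
qed

lemma isomorphic_geometries_sym:
  assumes "vector_space s" "module.subspace s (space G)" "ptP G \<subseteq> space G" "ptL G \<subseteq> space G"
    and iso: "isomorphic_geometries s t G H"
  shows "isomorphic_geometries t s H G"
proof -
  obtain f c where f: "c \<noteq> 0" "linear_iso_on s t (space G) (space H) f"
    "\<forall>v\<in>space G. form H (f v) = c * form G v" "f ` ptP G = ptP H" "f ` ptL G = ptL H"
    using iso unfolding isomorphic_geometries_def by blast
  let ?g = "inv_into (space G) f"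
  have bij: "inj_on f (space G)" "f ` space G = space H"
    using f(2) by (auto simp: linear_iso_on_def bij_betw_def)
  have "form G (?g v) = (1 / c) * form H v" if "v \<in> space H" for v
  proof -
    have "form H v = c * form G (?g v)"
      using that f(3) bij(2) inv_into_into[of v f "space G"] f_inv_into_f[of v f "space G"] by metis
    then show ?thesis using f(1) by simp
  qed
  \<comment> \<open>\<open>inv_into\<close> undoes \<open>f\<close> only on subsets of
    \<open>space G\<close>, which is why both points are assumed to lie in it.\<close>
  moreover have "?g ` ptP H = ptP G" "?g ` ptL H = ptL G"
    using f(4,5) assms(3,4) inv_into_image_cancel[OF bij(1)] by metis+
  moreover have "1 / c \<noteq> 0" using f(1) by simp
  ultimately show ?thesis
    using linear_iso_on_inv[OF assms(1,2) f(2)] unfolding isomorphic_geometries_def by blast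
qed

lemma isomorphic_geometries_trans:
  assumes "isomorphic_geometries s t G H" "isomorphic_geometries t r H K"
  shows "isomorphic_geometries s r G K"
proof -
  obtain f c where f: "c \<noteq> 0" "linear_iso_on s t (space G) (space H) f"
    "\<forall>v\<in>space G. form H (f v) = c * form G v" "f ` ptP G = ptP H" "f ` ptL G = ptL H"
    using assms(1) unfolding isomorphic_geometries_def by blast
  obtain g c' where g: "c' \<noteq> 0" "linear_iso_on t r (space H) (space K) g"
    "\<forall>v\<in>space H. form K (g v) = c' * form H v" "g ` ptP H = ptP K" "g ` ptL H = ptL K"
    using assms(2) unfolding isomorphic_geometries_def by blast
  have "f ` space G = space H" using f(2) by (auto simp: linear_iso_on_def bij_betw_def)
  then have "f v \<in> space H" if "v \<in> space G" for v using that by blast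
  then have "\<forall>v\<in>space G. form K ((g \<circ> f) v) = (c' * c) * form G v"
    using f(3) g(3) by (simp add: mult.assoc)
  moreover have "(g \<circ> f) ` ptP G = ptP K" "(g \<circ> f) ` ptL G = ptL K"
    by (simp_all only: image_comp[symmetric] f(4,5) g(4,5))
  moreover have "c' * c \<noteq> 0" using f(1) g(1) by simp
  ultimately show ?thesis
    using linear_iso_on_trans[OF f(2) g(2)] unfolding isomorphic_geometries_def by blast
qed

definition model_geometry ::
  "nat \<Rightarrow> (nat \<Rightarrow> 'k::field) \<Rightarrow> (nat \<Rightarrow> 'k) \<Rightarrow> ('k, nat \<Rightarrow> 'k) geometry" where
  "model_geometry n x y = \<lparr>space = coord_space n, form = sum_squares n,
     ptP = module.span seq_scale {x}, ptL = module.span seq_scale {y}\<rparr>"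

section \<open>Comparison of abstract geometries with the models\<close>

context regular_quadratic_space
begin

lemma linear_iso_on_comb:
  assumes "dim V = n" "n > 0" "orthonormal e n"
  shows "linear_iso_on seq_scale s (coord_space n) V (comb n e)"
proof -
  have "inj_on (comb n e) (coord_space n)"
  proof (rule inj_onI)
    fix x y assume xy: "x \<in> coord_space n" "y \<in> coord_space n" "comb n e x = comb n e y"
    have "x i = y i" for i
    proof (cases "i < n")
      case True
      from B_comb_unit[OF assms(3) this] xy(3) two_nonzero show ?thesis
        by (metis mult_cancel_left)
    qed (use xy in \<open>simp add: coord_space_def\<close>)
    then show "x = y" by blast
  qed
  moreover have "v \<in> comb n e ` coord_space n" if "v \<in> V" for v
  proof -
    have "v \<in> span (e ` {..<n})" using that orthonormal_span[of e] assms by simp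
    from span_orthonormal[OF assms(3) this] obtain x where "v = comb n e x" by blast
    \<comment> \<open>\<open>comb n\<close> reads only the indices below \<open>n\<close>, so
      cutting off the sequence puts it into \<open>coord_space n\<close>.\<close>
    also have "\<dots> = comb n e (\<lambda>i. if i < n then x i else 0)" by (simp add: comb_def)
    finally show ?thesis by (rule image_eqI[where f = "comb n e"]) (simp add: coord_space_def)
  qed
  ultimately have "bij_betw (comb n e) (coord_space n) V"
    using comb_in[OF assms(3)] unfolding bij_betw_def by blast
  then show ?thesis
    unfolding linear_iso_on_def comb_def
    by (simp add: seq_scale_def scale_left_distrib sum.distrib scale_sum_right)
qed

end

lemma universal_conformal_geometryE:
  fixes s :: "'k::field \<Rightarrow> 'v::ab_group_add \<Rightarrow> 'v"
  assumes G: "universal_conformal_geometry s d G"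
    and K: "quadratically_closed TYPE('k)" "(2::'k) \<noteq> 0" "vector_space s"
  obtains p l where "regular_quadratic_space s (space G) (form G)"
    "vector_space.dim s (space G) = d + 3" "p \<in> space G" "p \<noteq> 0" "l \<in> space G" "l \<noteq> 0"
    "ptP G = module.span s {p}" "ptL G = module.span s {l}" "polar (form G) p l = 0"
proof -
  have *: "regular_quadratic_space s (space G) (form G)"
    using G K unfolding universal_conformal_geometry_def
    by (intro regular_quadratic_space.intro regular_quadratic_space_axioms.intro) auto
  then interpret regular_quadratic_space s "space G" "form G" .
  from G show ?thesis
    unfolding universal_conformal_geometry_def projective_points_def
    by (auto simp: orthogonal_points_span intro: that[OF *])
qed

lemma geometry_standard_form:
  fixes s :: "'k::field \<Rightarrow> 'v::ab_group_add \<Rightarrow> 'v"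
  assumes G: "universal_conformal_geometry s d G"
    and K: "quadratically_closed TYPE('k)" "(2::'k) \<noteq> 0" "vector_space s"
  obtains e x y where
    "regular_quadratic_space s (space G) (form G)"
    "regular_quadratic_space.orthonormal (space G) (form G) e (d + 3)"
    "vector_space.dim s (space G) = d + 3"
    "standard_pair (d + 3) x y"
    "ptP G = module.span s {regular_quadratic_space.comb s (d + 3) e x}"
    "ptL G = module.span s {regular_quadratic_space.comb s (d + 3) e y}"
proof -
  obtain p l where *: "regular_quadratic_space s (space G) (form G)"
    and dim: "vector_space.dim s (space G) = d + 3" and p: "p \<in> space G" "p \<noteq> 0"
    and l: "l \<in> space G" "l \<noteq> 0" and pl: "polar (form G) p l = 0"
    and PL: "ptP G = module.span s {p}" "ptL G = module.span s {l}"
    by (rule universal_conformal_geometryE[OF G K])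
  interpret regular_quadratic_space s "space G" "form G" by fact
  from ex_standard_basis[OF dim _ p l pl] obtain e x y where
    "orthonormal e (d + 3)" "standard_pair (d + 3) x y"
    "span {p} = span {comb (d + 3) e x}" "span {l} = span {comb (d + 3) e y}" by auto
  then show ?thesis using that[OF *] dim PL by simp
qed

lemma standard_pair_in:
  assumes "standard_pair n x y" "n \<ge> 3"
  shows "x \<in> coord_space n" "y \<in> coord_space n" "x \<noteq> 0" "y \<noteq> 0"
  using assms
  by (auto simp: standard_pair_def unit_vec_in null_vec_in unit_vec_nonzero null_vec_nonzero)

text \<open>\<open>comb\<close> preserves the form exactly, so the scalar of the isomorphism is 1.
  The isometry is a separate conclusion because an isomorphism of geometries alone would allow a
  rescaled form.\<close>

lemma isomorphic_model_geometry:
  fixes s :: "'k::field \<Rightarrow> 'v::ab_group_add \<Rightarrow> 'v"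
  assumes G: "universal_conformal_geometry s d G"
    and K: "quadratically_closed TYPE('k)" "(2::'k) \<noteq> 0" "vector_space s"
  obtains x y where "standard_pair (d + 3) x y"
    "isometric_forms seq_scale s (coord_space (d + 3)) (sum_squares (d + 3)) (space G) (form G)"
    "isomorphic_geometries seq_scale s (model_geometry (d + 3) x y) G"
proof -
  let ?n = "d + 3"
  obtain e x y where *: "regular_quadratic_space s (space G) (form G)"
    and e: "regular_quadratic_space.orthonormal (space G) (form G) e ?n"
    and dim: "vector_space.dim s (space G) = ?n" and xy: "standard_pair ?n x y"
    and PL: "ptP G = module.span s {regular_quadratic_space.comb s ?n e x}"
      "ptL G = module.span s {regular_quadratic_space.comb s ?n e y}"
    by (rule geometry_standard_form[OF G K])
  interpret regular_quadratic_space s "space G" "form G" by fact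
  have iso: "linear_iso_on seq_scale s (coord_space ?n) (space G) (comb ?n e)"
    using linear_iso_on_comb[OF dim _ e] by simp
  have Q: "form G (comb ?n e v) = sum_squares ?n v" for v
    by (simp add: Q_comb[OF e] sum_squares_def)
  have xy_in: "x \<in> coord_space ?n" "y \<in> coord_space ?n" using standard_pair_in[OF xy] by simp_all
  note span_image = linear_iso_on_image_span_singleton[OF vector_space_seq_scale K(3) iso]
  have "isomorphic_geometries seq_scale s (model_geometry ?n x y) G"
    unfolding isomorphic_geometries_def model_geometry_def
    using iso Q PL span_image[OF xy_in(1)] span_image[OF xy_in(2)]
    by (intro exI[of _ "comb ?n e"] exI[of _ 1]) simp
  moreover have "isometric_forms seq_scale s (coord_space ?n) (sum_squares ?n) (space G) (form G)"
    unfolding isometric_forms_def using iso Q by blast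
  ultimately show ?thesis using xy that by blast
qed

lemma universal_conformal_geometry_points:
  assumes "universal_conformal_geometry s d G" "vector_space s"
  shows "module.subspace s (space G)" "ptP G \<subseteq> space G" "ptL G \<subseteq> space G"
proof -
  interpret vector_space s by fact
  show sub: "subspace (space G)"
    using assms by (simp add: universal_conformal_geometry_def)
  show "ptP G \<subseteq> space G" "ptL G \<subseteq> space G"
    using assms sub
    by (auto simp: universal_conformal_geometry_def projective_points_def span_singleton subspace_scale)
qed

lemma universal_conformal_geometry_model:
  assumes "quadratically_closed TYPE('k::field)" "(2::'k) \<noteq> 0" "standard_pair (d + 3) x y"
  shows "universal_conformal_geometry seq_scale d (model_geometry (d + 3) x (y :: nat \<Rightarrow> 'k))"
proof -
  let ?n = "d + 3"
  interpret regular_quadratic_space seq_scale "coord_space ?n" "sum_squares ?n :: _ \<Rightarrow> 'k"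
    using assms by (intro regular_quadratic_space_coord)
  have xy: "x \<in> coord_space ?n" "y \<in> coord_space ?n" "x \<noteq> 0" "y \<noteq> 0"
    using standard_pair_in[OF assms(3)] by simp_all
  have "polar (sum_squares ?n) x y = 0"
    using assms(3)
    by (auto simp: standard_pair_def polar_sum_squares_unit_vec polar_sum_squares_null_vec)
      (auto simp: unit_vec_def null_vec_def)
  then have "orthogonal_points (sum_squares ?n) (span {x}) (span {y})"
    using xy by (simp add: orthogonal_points_span)
  moreover have "nondegenerate_quadratic_on (coord_space ?n) (sum_squares ?n :: _ \<Rightarrow> 'k)"
    using nondegenerate
    by (auto simp: nondegenerate_bilinear_on_def nondegenerate_quadratic_on_def)
  ultimately show ?thesis
    using xy subspace_V quadratic nondegenerate dim_coord_space[of ?n, where 'k = 'k]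
    unfolding universal_conformal_geometry_def model_geometry_def projective_points_def by auto
qed

text \<open>Rests on \<open>\<iota> * \<iota> = - 1\<close>, which holds once the field is
  quadratically closed; the interpretation supplies it.\<close>

lemma sum_squares_null_vec:
  assumes "quadratically_closed TYPE('k::field)" "(2::'k) \<noteq> 0" "Suc j < n"
  shows "sum_squares n (null_vec j :: nat \<Rightarrow> 'k) = 0"
proof -
  interpret regular_quadratic_space seq_scale "coord_space n" "sum_squares n :: _ \<Rightarrow> 'k"
    using assms by (intro regular_quadratic_space_coord)
  show ?thesis using assms(3) by (simp add: sum_squares_def sum_null_vec) (simp add: null_vec_def)
qed

text \<open>Norms separate the pairs except for the two doubly singular ones. Of these, distinctness
  rules out (\<open>null_vec 0\<close>, \<open>null_vec 0\<close>) for \<open>n \<ge> 4\<close>, and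
  \<open>null_vec 2\<close> does not fit for \<open>n = 3\<close>.\<close>

lemma standard_pair_unique:
  assumes K: "quadratically_closed TYPE('k::field)" "(2::'k) \<noteq> 0" and n: "n \<ge> 3"
    and "standard_pair n x y" "standard_pair n x' (y' :: nat \<Rightarrow> 'k)"
    and "n \<ge> 4 \<Longrightarrow> x \<noteq> y" "n \<ge> 4 \<Longrightarrow> x' \<noteq> y'"
    and "sum_squares n x = 0 \<longleftrightarrow> sum_squares n x' = 0" "sum_squares n y = 0 \<longleftrightarrow> sum_squares n y' = 0"
  shows "x = x' \<and> y = y'"
proof -
  have "sum_squares n (unit_vec 0 :: nat \<Rightarrow> 'k) \<noteq> 0" "sum_squares n (unit_vec 1 :: nat \<Rightarrow> 'k) \<noteq> 0"
    using n by (simp_all add: sum_squares_unit_vec)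
  moreover have "sum_squares n (null_vec 0 :: nat \<Rightarrow> 'k) = 0" "sum_squares n (null_vec 1 :: nat \<Rightarrow> 'k) = 0"
    "n \<ge> 4 \<Longrightarrow> sum_squares n (null_vec 2 :: nat \<Rightarrow> 'k) = 0"
    using n by (simp_all add: sum_squares_null_vec[OF K])
  ultimately show ?thesis using assms(4-) unfolding standard_pair_def by auto
qed

text \<open>Vanishing on the whole line involves no representative and is visibly preserved by a map
  that multiplies the form by a non-zero scalar.\<close>

lemma point_norm_geometry:
  fixes s :: "'k::field \<Rightarrow> 'v::ab_group_add \<Rightarrow> 'v"
  assumes G: "universal_conformal_geometry s d G" and P: "P \<in> projective_points s (space G)"
    and K: "quadratically_closed TYPE('k)" "(2::'k) \<noteq> 0" "vector_space s"
  shows "point_norm (form G) P = (if \<forall>v\<in>P. form G v = 0 then square_class 0 else square_class 1)"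
proof -
  from G K interpret regular_quadratic_space s "space G" "form G"
    by (metis universal_conformal_geometryE)
  obtain v where v: "v \<in> space G" "v \<noteq> 0" "P = span {v}"
    using P unfolding projective_points_def by blast
  have "(\<forall>w\<in>P. form G w = 0) \<longleftrightarrow> form G v = 0"
    using v Q_scale[of v] by (auto simp: span_singleton span_base)
  then show ?thesis using point_norm_span[OF v(1,2)] v(3) by simp
qed

subsection \<open>Classification\<close>

lemma square_class_zero_neq_one: "square_class (0::'k::field) \<noteq> square_class 1"
proof -
  have "(1::'k) \<in> square_class 1" "(1::'k) \<notin> square_class 0"
    by (auto simp: square_class_def intro!: exI[of _ "1::'k"])
  then show ?thesis by metis
qed

lemma isomorphic_geometries_point_norm:
  fixes s :: "'k::field \<Rightarrow> 'v::ab_group_add \<Rightarrow> 'v" and s' :: "'k \<Rightarrow> 'w::ab_group_add \<Rightarrow> 'w"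
  assumes K: "quadratically_closed TYPE('k)" "(2::'k) \<noteq> 0" "vector_space s" "vector_space s'"
    and G: "universal_conformal_geometry s d G" and H: "universal_conformal_geometry s' d' H"
    and iso: "isomorphic_geometries s s' G H"
  shows "point_norm (form G) (ptP G) = point_norm (form H) (ptP H)"
    and "point_norm (form G) (ptL G) = point_norm (form H) (ptL H)"
proof -
  obtain f c where f: "c \<noteq> 0" "\<forall>v\<in>space G. form H (f v) = c * form G v"
    "f ` ptP G = ptP H" "f ` ptL G = ptL H"
    using iso unfolding isomorphic_geometries_def by blast
  note sub = universal_conformal_geometry_points[OF G K(3)]
  have "(\<forall>v\<in>f ` P. form H v = 0) \<longleftrightarrow> (\<forall>v\<in>P. form G v = 0)" if "P \<subseteq> space G" for P
    using f(1,2) that by (auto simp: subset_iff)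
  note zero = this[OF sub(2), unfolded f(3)] this[OF sub(3), unfolded f(4)]
  note norm = point_norm_geometry[OF G _ K(1-3)] point_norm_geometry[OF H _ K(1,2,4)]
  have "ptP G \<in> projective_points s (space G)" "ptL G \<in> projective_points s (space G)"
    "ptP H \<in> projective_points s' (space H)" "ptL H \<in> projective_points s' (space H)"
    using G H by (simp_all add: universal_conformal_geometry_def)
  then show "point_norm (form G) (ptP G) = point_norm (form H) (ptP H)"
    "point_norm (form G) (ptL G) = point_norm (form H) (ptL H)"
    by (simp_all add: norm zero)
qed

lemma point_norm_model:
  assumes K: "quadratically_closed TYPE('k::field)" "(2::'k) \<noteq> 0"
    and xy: "standard_pair n x (y :: nat \<Rightarrow> 'k)" "n \<ge> 3"
  shows "point_norm (form (model_geometry n x y)) (ptP (model_geometry n x y)) =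
      (if sum_squares n x = 0 then square_class 0 else square_class 1)"
    and "point_norm (form (model_geometry n x y)) (ptL (model_geometry n x y)) =
      (if sum_squares n y = 0 then square_class 0 else square_class 1)"
proof -
  interpret regular_quadratic_space seq_scale "coord_space n" "sum_squares n :: _ \<Rightarrow> 'k"
    using K by (intro regular_quadratic_space_coord)
  from standard_pair_in[OF xy] show
    "point_norm (form (model_geometry n x y)) (ptP (model_geometry n x y)) =
      (if sum_squares n x = 0 then square_class 0 else square_class 1)"
    "point_norm (form (model_geometry n x y)) (ptL (model_geometry n x y)) =
      (if sum_squares n y = 0 then square_class 0 else square_class 1)"
    by (simp_all add: model_geometry_def point_norm_span)
qed

lemma isomorphic_geometries_points_distinct:
  assumes "isomorphic_geometries s s' G H" "ptP H \<noteq> ptL H"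
  shows "ptP G \<noteq> ptL G"
  using assms unfolding isomorphic_geometries_def by metis

lemma isomorphic_geometries_iff:
  fixes s :: "'k::field \<Rightarrow> 'v::ab_group_add \<Rightarrow> 'v" and s' :: "'k \<Rightarrow> 'w::ab_group_add \<Rightarrow> 'w"
  assumes K: "quadratically_closed TYPE('k)" "(2::'k) \<noteq> 0" "vector_space s" "vector_space s'"
    and G: "proper_geometry s d G" and H: "proper_geometry s' d H"
  shows "isomorphic_geometries s s' G H \<longleftrightarrow>
    point_norm (form G) (ptP G) = point_norm (form H) (ptP H) \<and>
    point_norm (form G) (ptL G) = point_norm (form H) (ptL H)"
proof
  assume "isomorphic_geometries s s' G H"
  with G H show "point_norm (form G) (ptP G) = point_norm (form H) (ptP H) \<and>
    point_norm (form G) (ptL G) = point_norm (form H) (ptL H)"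
    using isomorphic_geometries_point_norm[OF K] unfolding proper_geometry_def by blast
next
  assume eq: "point_norm (form G) (ptP G) = point_norm (form H) (ptP H) \<and>
    point_norm (form G) (ptL G) = point_norm (form H) (ptL H)"
  let ?n = "d + 3"
  have uG: "universal_conformal_geometry s d G" and uH: "universal_conformal_geometry s' d H"
    using G H by (simp_all add: proper_geometry_def)
  obtain x y where xy: "standard_pair ?n x y" "isomorphic_geometries seq_scale s (model_geometry ?n x y) G"
    by (rule isomorphic_model_geometry[OF uG K(1-3)])
  obtain x' y' where xy': "standard_pair ?n x' y'"
    "isomorphic_geometries seq_scale s' (model_geometry ?n x' y') H"
    by (rule isomorphic_model_geometry[OF uH K(1,2,4)])
  note uM = universal_conformal_geometry_model[OF K(1,2) xy(1)]
  note uM' = universal_conformal_geometry_model[OF K(1,2) xy'(1)]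
  note norms = isomorphic_geometries_point_norm[OF K(1,2) vector_space_seq_scale K(3) uM uG xy(2)]
  note norms' = isomorphic_geometries_point_norm[OF K(1,2) vector_space_seq_scale K(4) uM' uH xy'(2)]
  \<comment> \<open>Equal norms force equal models, so \<open>G\<close> and \<open>H\<close> are
    isomorphic to one and the same geometry.\<close>
  have "x = x' \<and> y = y'"
  proof (rule standard_pair_unique[OF K(1,2) _ xy(1) xy'(1)])
    show "sum_squares ?n x = 0 \<longleftrightarrow> sum_squares ?n x' = 0"
      using eq norms(1) norms'(1) square_class_zero_neq_one[where 'k = 'k]
      by (auto simp: point_norm_model[OF K(1,2)] xy(1) xy'(1) split: if_splits)
    show "sum_squares ?n y = 0 \<longleftrightarrow> sum_squares ?n y' = 0"
      using eq norms(2) norms'(2) square_class_zero_neq_one[where 'k = 'k]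
      by (auto simp: point_norm_model[OF K(1,2)] xy(1) xy'(1) split: if_splits)
    \<comment> \<open>Distinctness of \<open>P\<close> and \<open>L\<close> passes from
      \<open>G\<close> to its model, where equal vectors would span equal lines.\<close>
    show "x \<noteq> y" if "?n \<ge> 4"
      using isomorphic_geometries_points_distinct[OF xy(2)] G that
      by (auto simp: proper_geometry_def model_geometry_def)
    show "x' \<noteq> y'" if "?n \<ge> 4"
      using isomorphic_geometries_points_distinct[OF xy'(2)] H that
      by (auto simp: proper_geometry_def model_geometry_def)
  qed simp
  then have xy'': "isomorphic_geometries seq_scale s' (model_geometry ?n x y) H" using xy'(2) by simp
  have "isomorphic_geometries s seq_scale G (model_geometry ?n x y)"
    using universal_conformal_geometry_points[OF uM vector_space_seq_scale] xy(2)
    by (intro isomorphic_geometries_sym[OF vector_space_seq_scale])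
  from isomorphic_geometries_trans[OF this xy''] show "isomorphic_geometries s s' G H" .
qed

lemma standard_pair_norms:
  assumes K: "quadratically_closed TYPE('k::field)" "(2::'k) \<noteq> 0" and n: "n \<ge> 3"
  obtains x y :: "nat \<Rightarrow> 'k::field" where "standard_pair n x y"
    "sum_squares n x = 0 \<longleftrightarrow> a" "sum_squares n y = 0 \<longleftrightarrow> b"
    "n \<ge> 4 \<longrightarrow> module.span seq_scale {x} \<noteq> module.span seq_scale {y}"
proof -
  interpret vector_space "seq_scale :: 'k \<Rightarrow> (nat \<Rightarrow> 'k) \<Rightarrow> _" by (rule vector_space_seq_scale)
  \<comment> \<open>A coordinate that vanishes at \<open>y\<close> vanishes on its whole line; index
    0 or 1 separates each pair below.\<close>
  have span_neq: "span {x} \<noteq> span {y}" if "x i \<noteq> 0" "y i = 0" for x y :: "nat \<Rightarrow> 'k" and i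
  proof
    assume "span {x} = span {y}"
    then have "x \<in> span {y}" using span_base[of x "{x}"] by simp
    then show False using that by (auto simp: span_singleton seq_scale_def)
  qed
  have Q: "sum_squares n (unit_vec 0 :: nat \<Rightarrow> 'k) \<noteq> 0" "sum_squares n (unit_vec 1 :: nat \<Rightarrow> 'k) \<noteq> 0"
    "sum_squares n (null_vec 0 :: nat \<Rightarrow> 'k) = 0" "sum_squares n (null_vec 1 :: nat \<Rightarrow> 'k) = 0"
    "n \<ge> 4 \<Longrightarrow> sum_squares n (null_vec 2 :: nat \<Rightarrow> 'k) = 0"
    using n by (simp_all add: sum_squares_unit_vec sum_squares_null_vec[OF K])
  have "span {unit_vec 0 :: nat \<Rightarrow> 'k} \<noteq> span {unit_vec 1}"
    "span {unit_vec 0 :: nat \<Rightarrow> 'k} \<noteq> span {null_vec 1}"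
    "span {null_vec 0 :: nat \<Rightarrow> 'k} \<noteq> span {null_vec 2}"
    by (rule span_neq[of _ 0]; simp add: unit_vec_def null_vec_def)+
  moreover have "span {null_vec 1 :: nat \<Rightarrow> 'k} \<noteq> span {unit_vec 0}"
    by (rule span_neq[of _ 1]) (simp_all add: unit_vec_def null_vec_def)
  ultimately have neq: "span {unit_vec 0 :: nat \<Rightarrow> 'k} \<noteq> span {unit_vec 1}"
    "span {unit_vec 0 :: nat \<Rightarrow> 'k} \<noteq> span {null_vec 1}"
    "span {null_vec 0 :: nat \<Rightarrow> 'k} \<noteq> span {null_vec 2}"
    "span {null_vec 1 :: nat \<Rightarrow> 'k} \<noteq> span {unit_vec 0}" .
  consider "\<not> a" "\<not> b" | "\<not> a" b | a "\<not> b" | a b "n \<ge> 4" | a b "\<not> n \<ge> 4" by blast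
  then show ?thesis
  proof cases
    case 1 then show ?thesis using that[of "unit_vec 0" "unit_vec 1"] Q neq standard_pair_intros by blast
  next
    case 2 then show ?thesis using that[of "unit_vec 0" "null_vec 1"] Q neq standard_pair_intros by blast
  next
    case 3 then show ?thesis using that[of "null_vec 1" "unit_vec 0"] Q neq standard_pair_intros by blast
  next
    case 4 then show ?thesis using that[of "null_vec 0" "null_vec 2"] Q neq standard_pair_intros by blast
  next
    \<comment> \<open>For \<open>n = 3\<close> both norms vanish only with P = L, and the
      distinctness condition is vacuous.\<close>
    case 5 then show ?thesis using that[of "null_vec 0" "null_vec 0"] Q standard_pair_intros by blast
  qed
qed

text \<open>The classes are the non-empty fibres of \<open>f\<close>, one for each value.\<close>

lemma card_quotient_eq_card_image:
  "card (X // {(x, y). x \<in> X \<and> y \<in> X \<and> f x = f y}) = card (f ` X)"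
proof -
  let ?c = "\<lambda>z. {y \<in> X. f y = z}"
  have "{(x, y). x \<in> X \<and> y \<in> X \<and> f x = f y} `` {x} = ?c (f x)" if "x \<in> X" for x
    using that by auto
  then have "X // {(x, y). x \<in> X \<and> y \<in> X \<and> f x = f y} = ?c ` f ` X"
    by (simp add: quotient_def image_image UNION_singleton_eq_range)
  moreover have "inj_on ?c (f ` X)" by (rule inj_onI) blast
  ultimately show ?thesis by (simp add: card_image)
qed

text \<open>On proper geometries isomorphism is the kernel of the pair of norms, so the classes are
  counted by the attained pairs. Each norm has two possible values, and suitable standard pairs
  realise all four combinations.\<close>

lemma card_geometry_classes:
  assumes K: "quadratically_closed TYPE('k::field)" "(2::'k) \<noteq> 0"
  shows "card (geometry_classes (seq_scale :: 'k \<Rightarrow> (nat \<Rightarrow> 'k) \<Rightarrow> _) d) = 4"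
proof -
  let ?s = "seq_scale :: 'k \<Rightarrow> (nat \<Rightarrow> 'k) \<Rightarrow> _"
  let ?X = "{G. proper_geometry ?s d G}"
  let ?N = "\<lambda>G :: ('k, nat \<Rightarrow> 'k) geometry.
    (point_norm (form G) (ptP G), point_norm (form G) (ptL G))"
  let ?C = "{square_class 0, square_class 1 :: 'k set}"
  note iff = isomorphic_geometries_iff[OF K vector_space_seq_scale vector_space_seq_scale]
  have "{(G, H). proper_geometry ?s d G \<and> proper_geometry ?s d H \<and> isomorphic_geometries ?s ?s G H} =
      {(G, H). G \<in> ?X \<and> H \<in> ?X \<and> ?N G = ?N H}"
    using iff by auto
  then have "card (geometry_classes ?s d) = card (?N ` ?X)"
    unfolding geometry_classes_def by (simp only: card_quotient_eq_card_image)
  also have "?N ` ?X = ?C \<times> ?C"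
  proof (intro subset_antisym subsetI)
    fix z assume "z \<in> ?N ` ?X"
    then obtain G where G: "proper_geometry ?s d G" "z = ?N G" by blast
    then have "universal_conformal_geometry ?s d G" by (simp add: proper_geometry_def)
    moreover from this have "ptP G \<in> projective_points ?s (space G)" "ptL G \<in> projective_points ?s (space G)"
      by (simp_all add: universal_conformal_geometry_def)
    ultimately show "z \<in> ?C \<times> ?C"
      unfolding G(2) using point_norm_geometry[OF _ _ K vector_space_seq_scale] by simp
  next
    fix z assume "z \<in> ?C \<times> ?C"
    then obtain a b where z: "z = (if a then square_class 0 else square_class 1,
      if b then square_class 0 else square_class 1)"
      by (cases z) (metis (full_types) insertE mem_Sigma_iff singletonD)
    obtain x y :: "nat \<Rightarrow> 'k" where xy: "standard_pair (d + 3) x y"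
      "sum_squares (d + 3) x = 0 \<longleftrightarrow> a" "sum_squares (d + 3) y = 0 \<longleftrightarrow> b"
      "d + 3 \<ge> 4 \<longrightarrow> module.span seq_scale {x} \<noteq> module.span seq_scale {y}"
      by (rule standard_pair_norms[OF K le_add2])
    have "proper_geometry ?s d (model_geometry (d + 3) x y)"
      using universal_conformal_geometry_model[OF K xy(1)] xy(4)
      by (simp add: proper_geometry_def model_geometry_def)
    moreover have "?N (model_geometry (d + 3) x y) = z"
      using point_norm_model[OF K xy(1)] xy(2,3) z by simp
    ultimately show "z \<in> ?N ` ?X" by blast
  qed
  also have "card (?C \<times> ?C) = 4"
    using square_class_zero_neq_one[where 'k = 'k] by (simp add: card_cartesian_product)
  finally show ?thesis .
qed

text \<open>If 2 = 0, the characteristic divides the prime 2; the remaining divisor 1 is impossible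
  in a field.\<close>

lemma two_nonzero_if_CHAR: "CHAR('k::field) \<noteq> 2 \<Longrightarrow> (2::'k) \<noteq> 0"
proof
  assume *: "CHAR('k) \<noteq> 2" "(2::'k) = 0"
  then have "of_nat 2 = (0::'k)" by simp
  then have "CHAR('k) dvd 2" by (simp only: of_nat_eq_0_iff_char_dvd)
  then have "CHAR('k) = 1" using *(1) two_is_prime_nat unfolding prime_nat_iff by blast
  then show False by simp
qed

text \<open>Both forms are isometric, without rescaling, to the sum of squares in
  \<open>d + 3\<close> coordinates.\<close>

lemma isometric_geometries:
  fixes s :: "'k::field \<Rightarrow> 'v::ab_group_add \<Rightarrow> 'v" and s' :: "'k \<Rightarrow> 'w::ab_group_add \<Rightarrow> 'w"
  assumes K: "quadratically_closed TYPE('k)" "(2::'k) \<noteq> 0" "vector_space s" "vector_space s'"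
    and G: "universal_conformal_geometry s d G" and H: "universal_conformal_geometry s' d H"
  shows "isometric_forms s s' (space G) (form G) (space H) (form H)"
proof -
  have "isometric_forms seq_scale s (coord_space (d + 3)) (sum_squares (d + 3)) (space G) (form G)"
    by (rule isomorphic_model_geometry[OF G K(1-3)])
  moreover have "isometric_forms seq_scale s' (coord_space (d + 3)) (sum_squares (d + 3)) (space H) (form H)"
    by (rule isomorphic_model_geometry[OF H K(1,2,4)])
  ultimately show ?thesis
    using isometric_forms_trans isometric_forms_sym[OF vector_space_seq_scale subspace_coord_space]
    by blast
qed

text \<open>The basis vectors are grouped in \<open>n div 2\<close> pairs, the last one being left
  over for odd \<open>n\<close>. The upper bound is only the dimension, as \<open>2 * m'\<close>
  independent vectors have to fit.\<close>

lemma ex_maximal_symplectic_subspace: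
  fixes s :: "'k::field \<Rightarrow> 'v::ab_group_add \<Rightarrow> 'v"
  assumes K: "quadratically_closed TYPE('k)" "(2::'k) \<noteq> 0" "vector_space s"
    and G: "universal_conformal_geometry s d G" and n: "n = d + 3"
  shows "\<exists>m W. 2 * m = (if even n then n else n - 1) \<and> W \<subseteq> space G \<and>
    symplectic_subspace s (form G) m W \<and>
    (\<forall>m' W'. W' \<subseteq> space G \<longrightarrow> symplectic_subspace s (form G) m' W' \<longrightarrow> m' \<le> m)"
proof -
  obtain e where *: "regular_quadratic_space s (space G) (form G)"
    and e: "regular_quadratic_space.orthonormal (space G) (form G) e n"
    and dim: "vector_space.dim s (space G) = n"
    unfolding n by (rule geometry_standard_form[OF G K])
  interpret regular_quadratic_space s "space G" "form G" by fact
  have m: "2 * (n div 2) = (if even n then n else n - 1)" by presburger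
  obtain W where "W \<subseteq> space G" "symplectic_subspace s (form G) (n div 2) W"
    using ex_symplectic_subspace[OF e, of "n div 2"] by auto
  moreover have "m' \<le> n div 2" if "W' \<subseteq> space G" "symplectic_subspace s (form G) m' W'" for m' W'
    using symplectic_subspace_le_dim[OF _ that(2,1)] dim n by simp
  ultimately show ?thesis using m by blast
qed

lemma proper_geometry_nondegenerate:
  fixes s :: "'k::field \<Rightarrow> 'v::ab_group_add \<Rightarrow> 'v"
  assumes K: "quadratically_closed TYPE('k)" "(2::'k) \<noteq> 0" "vector_space s"
    and G: "proper_geometry s d G" and d: "d + 3 \<ge> 4"
  shows "nondegenerate_geometry s G"
proof -
  have uG: "universal_conformal_geometry s d G" and neq: "ptP G \<noteq> ptL G"
    using G d by (simp_all add: proper_geometry_def)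
  show ?thesis
  proof (rule geometry_standard_form[OF uG K])
    fix e x y
    assume *: "regular_quadratic_space s (space G) (form G)"
    interpret regular_quadratic_space s "space G" "form G" by fact
    assume "orthonormal e (d + 3)" "dim (space G) = d + 3" "standard_pair (d + 3) x y"
      "ptP G = span {comb (d + 3) e x}" "ptL G = span {comb (d + 3) e y}"
    then show ?thesis using neq d by (intro nondegenerate_geometry_standard) auto
  qed
qed

text \<open>Relates the count, made inside the space of sequences, to arbitrary ambient spaces:
  every geometry has an isomorphic copy there.\<close>

lemma ex_isomorphic_seq_geometry:
  fixes s :: "'k::field \<Rightarrow> 'v::ab_group_add \<Rightarrow> 'v"
  assumes K: "quadratically_closed TYPE('k)" "(2::'k) \<noteq> 0" "vector_space s"
    and G: "universal_conformal_geometry s d G"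
  shows "\<exists>H::('k, nat \<Rightarrow> 'k) geometry.
    universal_conformal_geometry seq_scale d H \<and> isomorphic_geometries s seq_scale G H"
proof -
  obtain x y where xy: "standard_pair (d + 3) x y"
    "isomorphic_geometries seq_scale s (model_geometry (d + 3) x y) G"
    by (rule isomorphic_model_geometry[OF G K])
  note uM = universal_conformal_geometry_model[OF K(1,2) xy(1)]
  have "isomorphic_geometries s seq_scale G (model_geometry (d + 3) x y)"
    using universal_conformal_geometry_points[OF uM vector_space_seq_scale] xy(2)
    by (intro isomorphic_geometries_sym[OF vector_space_seq_scale])
  with uM show ?thesis by blast
qed

theorem mainTheorem6:
  fixes s :: "'k::field \<Rightarrow> 'v::ab_group_add \<Rightarrow> 'v"
    and s' :: "'k \<Rightarrow> 'w::ab_group_add \<Rightarrow> 'w"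
    and d n :: nat
  assumes "quadratically_closed TYPE('k)"
    and "CHAR('k) \<noteq> 2"
    and "vector_space s"
    and "vector_space s'"
    and "n = d + 3"
  shows
    "(\<forall>G H. universal_conformal_geometry s d G \<longrightarrow> universal_conformal_geometry s' d H \<longrightarrow>
        isometric_forms s s' (space G) (form G) (space H) (form H))
   \<and> (\<forall>G. universal_conformal_geometry s d G \<longrightarrow>
        (\<exists>m W. 2 * m = (if even n then n else n - 1) \<and> W \<subseteq> space G \<and>
           symplectic_subspace s (form G) m W \<and>
           (\<forall>m' W'. W' \<subseteq> space G \<longrightarrow> symplectic_subspace s (form G) m' W' \<longrightarrow> m' \<le> m)))
   \<and> (\<forall>G. proper_geometry s d G \<longrightarrow> n \<ge> 4 \<longrightarrow> nondegenerate_geometry s G)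
   \<and> (\<forall>G. universal_conformal_geometry s d G \<longrightarrow>
        point_norm (form G) (ptP G) \<in> {square_class 0, square_class 1} \<and>
        point_norm (form G) (ptL G) \<in> {square_class 0, square_class 1})
   \<and> (\<forall>G H. proper_geometry s d G \<longrightarrow> proper_geometry s' d H \<longrightarrow>
        (isomorphic_geometries s s' G H \<longleftrightarrow>
           point_norm (form G) (ptP G) = point_norm (form H) (ptP H) \<and>
           point_norm (form G) (ptL G) = point_norm (form H) (ptL H)))
   \<and> (\<forall>G. universal_conformal_geometry s d G \<longrightarrow>
        (\<exists>H::('k, nat \<Rightarrow> 'k) geometry.
           universal_conformal_geometry seq_scale d H \<and> isomorphic_geometries s seq_scale G H))
   \<and> card (geometry_classes (seq_scale :: 'k \<Rightarrow> (nat \<Rightarrow> 'k) \<Rightarrow> nat \<Rightarrow> 'k) d) = 4"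
proof (intro conjI allI impI)
  note two = two_nonzero_if_CHAR[OF assms(2)]
  note K = assms(1) two assms(3)
  show "isometric_forms s s' (space G) (form G) (space H) (form H)"
    if "universal_conformal_geometry s d G" "universal_conformal_geometry s' d H" for G H
    using isometric_geometries[OF K assms(4) that] .
  show "\<exists>m W. 2 * m = (if even n then n else n - 1) \<and> W \<subseteq> space G \<and>
      symplectic_subspace s (form G) m W \<and>
      (\<forall>m' W'. W' \<subseteq> space G \<longrightarrow> symplectic_subspace s (form G) m' W' \<longrightarrow> m' \<le> m)"
    if "universal_conformal_geometry s d G" for G
    using ex_maximal_symplectic_subspace[OF K that assms(5)] .
  show "nondegenerate_geometry s G" if "proper_geometry s d G" "n \<ge> 4" for G
    using proper_geometry_nondegenerate[OF K that(1)] that(2) assms(5) by simp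
  show "point_norm (form G) (ptP G) \<in> {square_class 0, square_class 1}"
    "point_norm (form G) (ptL G) \<in> {square_class 0, square_class 1}"
    if G: "universal_conformal_geometry s d G" for G
    using G point_norm_geometry[OF G _ K] by (simp_all add: universal_conformal_geometry_def)
  show "\<exists>H::('k, nat \<Rightarrow> 'k) geometry.
      universal_conformal_geometry seq_scale d H \<and> isomorphic_geometries s seq_scale G H"
    if "universal_conformal_geometry s d G" for G
    using ex_isomorphic_seq_geometry[OF K that] .
  show "isomorphic_geometries s s' G H \<longleftrightarrow>
      point_norm (form G) (ptP G) = point_norm (form H) (ptP H) \<and>
      point_norm (form G) (ptL G) = point_norm (form H) (ptL H)"
    if "proper_geometry s d G" "proper_geometry s' d H" for G H
    using isomorphic_geometries_iff[OF K assms(4) that] .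
  show "card (geometry_classes (seq_scale :: 'k \<Rightarrow> (nat \<Rightarrow> 'k) \<Rightarrow> nat \<Rightarrow> 'k) d) = 4"
    using card_geometry_classes[OF assms(1) two] .
qed

end
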